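(* Let $\Bbbk$ be a field and let $\mathcal{B}$ be a $\Bbbk$-linear pivotal bicategory which is monoidal with duals and such that $\mathcal{B}(\mathbb{O},\mathbb{O})\cong \mathrm{Vect}_{\Bbbk}$, where $\mathbb{O}\in\mathcal{B}$ is the monoidal unit object. Then for every object $\alpha\in\mathcal{B}$, the vector space $\mathrm{End}(1_\alpha)$ of 2-endomorphisms of the unit 1-morphism $1_\alpha$ naturally has the structure of a commutative Frobenius algebra over $\Bbbk$: the multiplication is composition of 2-morphisms and the nondegenerate pairing is $$\langle \phi_1,\phi_2\rangle_\alpha = \mathrm{ev}_{\widetilde 1_\alpha}\circ\big(1_{\widetilde 1_\alpha^\dagger}\otimes \widetilde\phi_1\widetilde\phi_2\big)\circ\widetilde{\mathrm{coev}}_{\widetilde 1_\alpha}\in \mathrm{End}(1_{\mathbb{O}})\cong\Bbbk ,\qquad \phi_1,\phi_2\in\mathrm{End}(1_\alpha),$$ where $\widetilde 1_\alpha\in\mathcal{B}(\mathbb{O},\alpha\,\square\,\alpha^{\#})$ and $\widetilde\phi\in\mathrm{End}(\widetilde 1_\alpha)$ are the 1-morphism and 2-morphism corresponding to $1_\alpha$ and $\phi\in\mathrm{End}(1_\alpha)$ under duality in $\mathcal{B}$.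
   Context: Conventions for 2-categories. Bicategories are treated as strict 2-categories (every pivotal bicategory is equivalent to a pivotal 2-category). For objects $\alpha,\beta$ of $\mathcal{B}$, $\mathcal{B}(\alpha,\beta)$ is the category of 1-morphisms $\alpha\to\beta$; its morphisms are the 2-morphisms, with composition $\circ$ (also written by juxtaposition). Horizontal composition is $\otimes:\mathcal{B}(\beta,\gamma)\times\mathcal{B}(\alpha,\beta)\to\mathcal{B}(\alpha,\gamma)$, with unit 1-morphisms $1_\alpha$. $\Bbbk$-linear means that 2-morphism sets are $\Bbbk$-vector spaces and both compositions are $\Bbbk$-(bi)linear. Pivotal. A left adjoint of $X\in\mathcal{B}(\alpha,\beta)$ is ${}^\dagger X\in\mathcal{B}(\beta,\alpha)$ with 2-morphisms $\mathrm{ev}_X:{}^\dagger X\otimes X\to 1_\alpha$, $\mathrm{coev}_X:1_\beta\to X\otimes{}^\dagger X$ satisfying $(1_X\otimes\mathrm{ev}_X)\circ(\mathrm{coev}_X\otimes 1_X)=1_X$ and $(\mathrm{ev}_X\otimes 1_{{}^\dagger X})\circ(1_{{}^\dagger X}\otimes\mathrm{coev}_X)=1_{{}^\dagger X}$. A right adjoint is $X^\dagger\in\mathcal{B}(\beta,\alpha)$ with $\widetilde{\mathrm{ev}}_X:X\otimes X^\dagger\to 1_\beta$, $\widetilde{\mathrm{coev}}_X:1_\alpha\to X^\dagger\otimes X$ satisfying $(\widetilde{\mathrm{ev}}_X\otimes 1_X)\circ(1_X\otimes\widetilde{\mathrm{coev}}_X)=1_X$ and $(1_{X^\dagger}\otimes\widetilde{\mathrm{ev}}_X)\circ(\widetilde{\mathrm{coev}}_X\otimes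 1_{X^\dagger})=1_{X^\dagger}$. $\mathcal{B}$ is pivotal if every 1-morphism has chosen left and right adjoints with ${}^\dagger X=X^\dagger$, such that: (1) for every 2-morphism $\Phi:X\to Z$ one has $(\mathrm{ev}_Z\otimes 1)\circ(1\otimes\Phi\otimes 1)\circ(1_{{}^\dagger Z}\otimes\mathrm{coev}_X)=(1\otimes\widetilde{\mathrm{ev}}_Z)\circ(1\otimes\Phi\otimes 1)\circ(\widetilde{\mathrm{coev}}_X\otimes 1_{Z^\dagger})$ as maps $Z^\dagger\to X^\dagger$; (2) for composable $X:\alpha\to\beta$, $Y:\beta\to\gamma$, the two maps $(Y\otimes X)^\dagger\to X^\dagger\otimes Y^\dagger$ given by $(1\otimes\widetilde{\mathrm{ev}}_{Y\otimes X})\circ(1_{X^\dagger}\otimes\widetilde{\mathrm{coev}}_Y\otimes 1)\circ(\widetilde{\mathrm{coev}}_X\otimes 1)$ and by $(\mathrm{ev}_{Y\otimes X}\otimes 1)\circ(1\otimes\mathrm{coev}_X\otimes 1_{Y^\dagger})\circ(1\otimes\mathrm{coev}_Y)$ coincide. Monoidal with duals. This means that $\mathcal{B}$ is the 2-category underlying a Gray category with duals with a single object (in the sense of Barrett–Meusburger–Schaumann). That is: there are a unit object $\mathbb{O}$ and, for each object $\alpha$, strict 2-functors $\alpha\,\square\,(-)$ and $(-)\,\square\,\alpha$ preserving the pivotal structure, strictly associative and unital, together with invertible, natural and coherent interchange 2-morphisms between $(X\,\square\,\beta')\otimes(\alpha\,\square\,Y)$ and $(\alpha'\,\square\,Y)\otimes(X\,\square\,\beta)$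 for $X:\alpha\to\alpha'$, $Y:\beta\to\beta'$. Moreover each object $\alpha$ has a dual $\alpha^{\#}$ with $\alpha^{\#\#}=\alpha$, $\mathbb{O}^{\#}=\mathbb{O}$, $(\alpha\,\square\,\beta)^{\#}=\beta^{\#}\,\square\,\alpha^{\#}$, a fold 1-morphism $\eta_\alpha:\mathbb{O}\to\alpha\,\square\,\alpha^{\#}$ with $\eta_{\mathbb{O}}=1_{\mathbb{O}}$ and $\eta_{\alpha\square\beta}=(\alpha\,\square\,\eta_\beta\,\square\,\alpha^{\#})\otimes\eta_\alpha$, and an invertible triangulator 2-morphism $T_\alpha:(\eta_\alpha^\dagger\,\square\,\alpha)\otimes(\alpha\,\square\,\eta_{\alpha^{\#}})\to 1_\alpha$, compatible with $\square$ and units and satisfying the swallowtail identity. Duality in $\mathcal{B}$ gives equivalences $\mathcal{B}(\alpha,\beta)\to\mathcal{B}(\mathbb{O},\beta\,\square\,\alpha^{\#})$, $X\mapsto (X\,\square\,\alpha^{\#})\otimes\eta_\alpha$. Under the one with $\beta=\alpha$, $1_\alpha$ corresponds to $\widetilde 1_\alpha=\eta_\alpha$ and $\phi\in\mathrm{End}(1_\alpha)$ corresponds to $\widetilde\phi=(\phi\,\square\,\alpha^{\#})\otimes 1_{\eta_\alpha}$. $\mathrm{Vect}_{\Bbbk}$ is the category of finite-dimensional $\Bbbk$-vector spaces, and $\mathcal{B}(\mathbb{O},\mathbb{O})\cong\mathrm{Vect}_{\Bbbk}$ is an equivalence of $\Bbbk$-linear monoidal categories ($\otimes$ corresponding to $\otimes_{\Bbbk}$);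 in particular $\mathrm{End}(1_{\mathbb{O}})\cong\Bbbk$. A commutative Frobenius algebra is a commutative unital $\Bbbk$-algebra $A$, finite-dimensional, with a nondegenerate bilinear pairing satisfying $\langle ab,c\rangle=\langle a,bc\rangle$.
   Formalization: The functors α□(−) and (−)□α are additionally required to be 𝕜-linear on 2-morphisms; without this (e.g. if they act by complex conjugation) the pairing need not be 𝕜-bilinear. *)

theory Defs
  imports "HOL-Algebra.Module" "HOL-Library.Nat_Bijection" "HOL-Library.FuncSet"
begin

section \<open>Linear algebra over a field\<close>

text \<open>Vector spaces over a field \<open>K\<close> are modules over \<open>K\<close> in the sense of HOL-Algebra.\<close>

definition linear_map ::
  "('k, 'r) ring_scheme \<Rightarrow> ('k, 'a, 's) module_scheme \<Rightarrow> ('k, 'b, 't) module_scheme \<Rightarrow> ('a \<Rightarrow> 'b) \<Rightarrow> bool"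
  where "linear_map K M N f \<longleftrightarrow>
    f \<in> carrier M \<rightarrow> carrier N \<and>
    (\<forall>x\<in>carrier M. \<forall>y\<in>carrier M. f (x \<oplus>\<^bsub>M\<^esub> y) = f x \<oplus>\<^bsub>N\<^esub> f y) \<and>
    (\<forall>c\<in>carrier K. \<forall>x\<in>carrier M. f (c \<odot>\<^bsub>M\<^esub> x) = c \<odot>\<^bsub>N\<^esub> f x)"

definition finite_dimensional :: "('k, 'r) ring_scheme \<Rightarrow> ('k, 'a, 's) module_scheme \<Rightarrow> bool"
  where "finite_dimensional K M \<longleftrightarrow>
    (\<exists>S. finite S \<and> S \<subseteq> carrier M \<and>
      (\<forall>x\<in>carrier M. \<exists>c\<in>S \<rightarrow> carrier K. x = (\<Oplus>\<^bsub>M\<^esub>s\<in>S. c s \<odot>\<^bsub>M\<^esub> s)))"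

text \<open>The locale \<open>algebra\<close> of HOL-Algebra is that of commutative unital algebras.\<close>

locale commutative_frobenius_algebra = algebra K A
  for K :: "('k, 'r) ring_scheme" and A :: "('k, 'a, 's) module_scheme" +
  fixes form :: "'a \<Rightarrow> 'a \<Rightarrow> 'k"
  assumes field: "field K"
    and finite_dim: "finite_dimensional K A"
    and form_closed: "\<lbrakk>a \<in> carrier A; b \<in> carrier A\<rbrakk> \<Longrightarrow> form a b \<in> carrier K"
    and form_add_left: "\<lbrakk>a \<in> carrier A; b \<in> carrier A; c \<in> carrier A\<rbrakk> \<Longrightarrow>
      form (a \<oplus>\<^bsub>A\<^esub> b) c = form a c \<oplus>\<^bsub>K\<^esub> form b c"
    and form_add_right: "\<lbrakk>a \<in> carrier A; b \<in> carrier A; c \<in> carrier A\<rbrakk> \<Longrightarrow>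
      form a (b \<oplus>\<^bsub>A\<^esub> c) = form a b \<oplus>\<^bsub>K\<^esub> form a c"
    and form_smult_left: "\<lbrakk>r \<in> carrier K; a \<in> carrier A; b \<in> carrier A\<rbrakk> \<Longrightarrow>
      form (r \<odot>\<^bsub>A\<^esub> a) b = r \<otimes>\<^bsub>K\<^esub> form a b"
    and form_smult_right: "\<lbrakk>r \<in> carrier K; a \<in> carrier A; b \<in> carrier A\<rbrakk> \<Longrightarrow>
      form a (r \<odot>\<^bsub>A\<^esub> b) = r \<otimes>\<^bsub>K\<^esub> form a b"
    and form_assoc: "\<lbrakk>a \<in> carrier A; b \<in> carrier A; c \<in> carrier A\<rbrakk> \<Longrightarrow>
      form (a \<otimes>\<^bsub>A\<^esub> b) c = form a (b \<otimes>\<^bsub>A\<^esub> c)"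
    and nondegenerate_left: "\<lbrakk>a \<in> carrier A; \<And>b. b \<in> carrier A \<Longrightarrow> form a b = \<zero>\<^bsub>K\<^esub>\<rbrakk> \<Longrightarrow> a = \<zero>\<^bsub>A\<^esub>"
    and nondegenerate_right: "\<lbrakk>b \<in> carrier A; \<And>a. a \<in> carrier A \<Longrightarrow> form a b = \<zero>\<^bsub>K\<^esub>\<rbrakk> \<Longrightarrow> b = \<zero>\<^bsub>A\<^esub>"


section \<open>Equivalences of linear monoidal categories\<close>

text \<open>Morphism spaces are vector spaces, recorded as \<open>module\<close> records; the \<open>mult\<close> and \<open>one\<close> fields
  of these records carry no information.\<close>

record ('k, 'a, 'h) linear_monoidal_category =
  MObj :: "'a set"
  MHom :: "'a \<Rightarrow> 'a \<Rightarrow> ('k, 'h) module"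
  Mid :: "'a \<Rightarrow> 'h"
  Mcomp :: "'h \<Rightarrow> 'h \<Rightarrow> 'h"
  Munit :: "'a"
  Mtensor :: "'a \<Rightarrow> 'a \<Rightarrow> 'a"
  Mtensor_hom :: "'h \<Rightarrow> 'h \<Rightarrow> 'h"
  Massoc :: "'a \<Rightarrow> 'a \<Rightarrow> 'a \<Rightarrow> 'h"    \<comment> \<open>\<open>(U \<otimes> V) \<otimes> W \<rightarrow> U \<otimes> (V \<otimes> W)\<close>\<close>
  Mlunit :: "'a \<Rightarrow> 'h"    \<comment> \<open>\<open>1 \<otimes> V \<rightarrow> V\<close>\<close>
  Mrunit :: "'a \<Rightarrow> 'h"    \<comment> \<open>\<open>V \<otimes> 1 \<rightarrow> V\<close>\<close>

definition M_iso :: "('k, 'a, 'h, 'z) linear_monoidal_category_scheme \<Rightarrow> 'a \<Rightarrow> 'a \<Rightarrow> 'h \<Rightarrow> bool"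
  where "M_iso C V W f \<longleftrightarrow> f \<in> carrier (MHom C V W) \<and>
    (\<exists>g\<in>carrier (MHom C W V). Mcomp C g f = Mid C V \<and> Mcomp C f g = Mid C W)"

text \<open>A strong monoidal \<open>K\<close>-linear functor \<open>(F\<^sub>0, F\<^sub>1, \<mu>, \<epsilon>)\<close> which is fully faithful and
  essentially surjective.\<close>

locale linear_monoidal_equivalence =
  fixes K :: "('k, 'r) ring_scheme"
    and C :: "('k, 'a, 'h) linear_monoidal_category"
    and D :: "('k, 'b, 'g) linear_monoidal_category"
    and F\<^sub>0 :: "'a \<Rightarrow> 'b"
    and F\<^sub>1 :: "'a \<Rightarrow> 'a \<Rightarrow> 'h \<Rightarrow> 'g"
    and \<mu> :: "'a \<Rightarrow> 'a \<Rightarrow> 'g"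
    and \<epsilon> :: "'g"
  assumes obj: "X \<in> MObj C \<Longrightarrow> F\<^sub>0 X \<in> MObj D"
    and linear: "\<lbrakk>X \<in> MObj C; Y \<in> MObj C\<rbrakk> \<Longrightarrow>
      linear_map K (MHom C X Y) (MHom D (F\<^sub>0 X) (F\<^sub>0 Y)) (F\<^sub>1 X Y)"
    and ident: "X \<in> MObj C \<Longrightarrow> F\<^sub>1 X X (Mid C X) = Mid D (F\<^sub>0 X)"
    and comp: "\<lbrakk>X \<in> MObj C; Y \<in> MObj C; Z \<in> MObj C;
        f \<in> carrier (MHom C X Y); g \<in> carrier (MHom C Y Z)\<rbrakk> \<Longrightarrow>
      F\<^sub>1 X Z (Mcomp C g f) = Mcomp D (F\<^sub>1 Y Z g) (F\<^sub>1 X Y f)"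
    and fully_faithful: "\<lbrakk>X \<in> MObj C; Y \<in> MObj C\<rbrakk> \<Longrightarrow>
      bij_betw (F\<^sub>1 X Y) (carrier (MHom C X Y)) (carrier (MHom D (F\<^sub>0 X) (F\<^sub>0 Y)))"
    and essentially_surjective: "W \<in> MObj D \<Longrightarrow> \<exists>X\<in>MObj C. \<exists>f. M_iso D (F\<^sub>0 X) W f"
    and unit_iso: "M_iso D (Munit D) (F\<^sub>0 (Munit C)) \<epsilon>"
    and tensor_iso: "\<lbrakk>X \<in> MObj C; Y \<in> MObj C\<rbrakk> \<Longrightarrow>
      M_iso D (Mtensor D (F\<^sub>0 X) (F\<^sub>0 Y)) (F\<^sub>0 (Mtensor C X Y)) (\<mu> X Y)"
    and tensor_natural: "\<lbrakk>X \<in> MObj C; X' \<in> MObj C; Y \<in> MObj C; Y' \<in> MObj C;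
        f \<in> carrier (MHom C X X'); g \<in> carrier (MHom C Y Y')\<rbrakk> \<Longrightarrow>
      Mcomp D (\<mu> X' Y') (Mtensor_hom D (F\<^sub>1 X X' f) (F\<^sub>1 Y Y' g)) =
      Mcomp D (F\<^sub>1 (Mtensor C X Y) (Mtensor C X' Y') (Mtensor_hom C f g)) (\<mu> X Y)"
    and associativity: "\<lbrakk>X \<in> MObj C; Y \<in> MObj C; Z \<in> MObj C\<rbrakk> \<Longrightarrow>
      Mcomp D (F\<^sub>1 (Mtensor C (Mtensor C X Y) Z) (Mtensor C X (Mtensor C Y Z)) (Massoc C X Y Z))
        (Mcomp D (\<mu> (Mtensor C X Y) Z) (Mtensor_hom D (\<mu> X Y) (Mid D (F\<^sub>0 Z)))) =
      Mcomp D (\<mu> X (Mtensor C Y Z))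
        (Mcomp D (Mtensor_hom D (Mid D (F\<^sub>0 X)) (\<mu> Y Z)) (Massoc D (F\<^sub>0 X) (F\<^sub>0 Y) (F\<^sub>0 Z)))"
    and left_unitality: "X \<in> MObj C \<Longrightarrow>
      Mcomp D (F\<^sub>1 (Mtensor C (Munit C) X) X (Mlunit C X))
        (Mcomp D (\<mu> (Munit C) X) (Mtensor_hom D \<epsilon> (Mid D (F\<^sub>0 X)))) = Mlunit D (F\<^sub>0 X)"
    and right_unitality: "X \<in> MObj C \<Longrightarrow>
      Mcomp D (F\<^sub>1 (Mtensor C X (Munit C)) X (Mrunit C X))
        (Mcomp D (\<mu> X (Munit C)) (Mtensor_hom D (Mid D (F\<^sub>0 X)) \<epsilon>)) = Mrunit D (F\<^sub>0 X)"

definition linear_monoidally_equivalent ::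
  "('k, 'r) ring_scheme \<Rightarrow> ('k, 'a, 'h) linear_monoidal_category \<Rightarrow>
   ('k, 'b, 'g) linear_monoidal_category \<Rightarrow> bool"
  where "linear_monoidally_equivalent K C D \<longleftrightarrow>
    (\<exists>F\<^sub>0 F\<^sub>1 \<mu> \<epsilon>. linear_monoidal_equivalence K C D F\<^sub>0 F\<^sub>1 \<mu> \<epsilon>)"


section \<open>The monoidal category of finite-dimensional vector spaces\<close>

text \<open>A small model of the category of all finite-dimensional vector spaces: its objects are the
  finite-dimensional subspaces of the space \<open>K\<^sup>\<nat>\<close> of sequences, so that every finite-dimensional
  vector space is isomorphic to an object. The tensor product \<open>V \<otimes> W\<close> is realised inside
  \<open>K\<^sup>\<nat>\<^sup>\<times>\<^sup>\<nat>\<close> as the span of the elements \<open>(v i * w j)\<^sub>i\<^sub>j\<close> (over a field the canonical map from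
  \<open>V \<otimes> W\<close> to \<open>K\<^sup>\<nat>\<^sup>\<times>\<^sup>\<nat>\<close> is injective), and \<open>\<nat> \<times> \<nat>\<close> is identified with \<open>\<nat>\<close> by \<open>prod_encode\<close>.\<close>

definition sequences :: "('k, 'r) ring_scheme \<Rightarrow> ('k, nat \<Rightarrow> 'k) module"
  where "sequences K = \<lparr>carrier = UNIV \<rightarrow> carrier K, mult = undefined, one = undefined,
    zero = (\<lambda>n. \<zero>\<^bsub>K\<^esub>), add = (\<lambda>v w n. v n \<oplus>\<^bsub>K\<^esub> w n), smult = (\<lambda>c v n. c \<otimes>\<^bsub>K\<^esub> v n)\<rparr>"

definition subspace_of_sequences :: "('k, 'r) ring_scheme \<Rightarrow> (nat \<Rightarrow> 'k) set \<Rightarrow> ('k, nat \<Rightarrow> 'k) module"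
  where "subspace_of_sequences K V = (sequences K)\<lparr>carrier := V\<rparr>"

definition pure_tensor :: "('k, 'r) ring_scheme \<Rightarrow> (nat \<Rightarrow> 'k) \<Rightarrow> (nat \<Rightarrow> 'k) \<Rightarrow> nat \<Rightarrow> 'k"
  where "pure_tensor K v w n = (case prod_decode n of (i, j) \<Rightarrow> v i \<otimes>\<^bsub>K\<^esub> w j)"

definition tensor_space ::
  "('k, 'r) ring_scheme \<Rightarrow> (nat \<Rightarrow> 'k) set \<Rightarrow> (nat \<Rightarrow> 'k) set \<Rightarrow> (nat \<Rightarrow> 'k) set"
  where "tensor_space K V W =
    {\<Oplus>\<^bsub>sequences K\<^esub>i\<in>{..<m}. pure_tensor K (v i) (w i) | (m::nat) v w.
      v \<in> {..<m} \<rightarrow> V \<and> w \<in> {..<m} \<rightarrow> W}"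

text \<open>A morphism is a linear map together with its domain and codomain.\<close>

type_synonym 'k vect_hom =
  "(nat \<Rightarrow> 'k) set \<times> (nat \<Rightarrow> 'k) set \<times> ((nat \<Rightarrow> 'k) \<Rightarrow> (nat \<Rightarrow> 'k))"

definition Vect_Hom ::
  "('k, 'r) ring_scheme \<Rightarrow> (nat \<Rightarrow> 'k) set \<Rightarrow> (nat \<Rightarrow> 'k) set \<Rightarrow> ('k, 'k vect_hom) module"
  where "Vect_Hom K V W =
    \<lparr>carrier = {(V, W, f) | f. f \<in> extensional V \<and>
        linear_map K (subspace_of_sequences K V) (subspace_of_sequences K W) f},
      mult = undefined, one = undefined,
      zero = (V, W, \<lambda>x\<in>V. \<zero>\<^bsub>sequences K\<^esub>),
      add = (\<lambda>(_, _, f) (_, _, g). (V, W, \<lambda>x\<in>V. f x \<oplus>\<^bsub>sequences K\<^esub> g x)),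
      smult = (\<lambda>c (_, _, f). (V, W, \<lambda>x\<in>V. c \<odot>\<^bsub>sequences K\<^esub> f x))\<rparr>"

fun Vect_comp :: "'k vect_hom \<Rightarrow> 'k vect_hom \<Rightarrow> 'k vect_hom"
  where "Vect_comp (_, W, g) (U, _, f) = (U, W, compose U g f)"

fun Vect_tensor_hom :: "('k, 'r) ring_scheme \<Rightarrow> 'k vect_hom \<Rightarrow> 'k vect_hom \<Rightarrow> 'k vect_hom"
  where "Vect_tensor_hom K (V, V', f) (W, W', g) =
    (THE h. h \<in> carrier (Vect_Hom K (tensor_space K V W) (tensor_space K V' W')) \<and>
      (\<forall>v\<in>V. \<forall>w\<in>W. snd (snd h) (pure_tensor K v w) = pure_tensor K (f v) (g w)))"

text \<open>The associator sends \<open>(u \<otimes> v) \<otimes> w\<close> to \<open>u \<otimes> (v \<otimes> w)\<close>. The unit object consists of the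
  sequences supported at \<open>0\<close>, that is, \<open>K\<close> itself; the unitors send
  \<open>(c, 0, 0, \<dots>) \<otimes> v\<close> and \<open>v \<otimes> (c, 0, 0, \<dots>)\<close> to \<open>c v\<close>.\<close>

definition Vect :: "('k, 'r) ring_scheme \<Rightarrow> ('k, (nat \<Rightarrow> 'k) set, 'k vect_hom) linear_monoidal_category"
  where "Vect K =
    \<lparr>MObj = {V. submodule V K (sequences K) \<and> finite_dimensional K (subspace_of_sequences K V)},
      MHom = Vect_Hom K,
      Mid = (\<lambda>V. (V, V, \<lambda>x\<in>V. x)),
      Mcomp = Vect_comp,
      Munit = {v \<in> UNIV \<rightarrow> carrier K. \<forall>n>0. v n = \<zero>\<^bsub>K\<^esub>},
      Mtensor = tensor_space K,
      Mtensor_hom = Vect_tensor_hom K,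
      Massoc = (\<lambda>U V W.
        (tensor_space K (tensor_space K U V) W, tensor_space K U (tensor_space K V W),
         \<lambda>t\<in>tensor_space K (tensor_space K U V) W.
           \<lambda>n. case prod_decode n of (i, m) \<Rightarrow> case prod_decode m of (j, k) \<Rightarrow>
             t (prod_encode (prod_encode (i, j), k)))),
      Mlunit = (\<lambda>V.
        (tensor_space K {v \<in> UNIV \<rightarrow> carrier K. \<forall>n>0. v n = \<zero>\<^bsub>K\<^esub>} V, V,
         \<lambda>t\<in>tensor_space K {v \<in> UNIV \<rightarrow> carrier K. \<forall>n>0. v n = \<zero>\<^bsub>K\<^esub>} V.
           \<lambda>n. t (prod_encode (0, n)))),
      Mrunit = (\<lambda>V.
        (tensor_space K V {v \<in> UNIV \<rightarrow> carrier K. \<forall>n>0. v n = \<zero>\<^bsub>K\<^esub>}, V,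
         \<lambda>t\<in>tensor_space K V {v \<in> UNIV \<rightarrow> carrier K. \<forall>n>0. v n = \<zero>\<^bsub>K\<^esub>}.
           \<lambda>n. t (prod_encode (n, 0))))\<rparr>"


section \<open>Linear strict 2-categories\<close>

text \<open>\<open>\<B> \<alpha> \<beta>\<close> is the set of 1-morphisms \<open>\<alpha> \<rightarrow> \<beta>\<close>, and \<open>\<H> X Y\<close> the vector space of 2-morphisms
  \<open>X \<rightarrow> Y\<close> (for parallel \<open>X\<close>, \<open>Y\<close>). Vertical composition is \<open>\<cdot>\<close>; horizontal composition is \<open>\<star>\<close>
  on 1-morphisms and \<open>\<bullet>\<close> on 2-morphisms, with \<open>Y \<star> X\<close> meaning \<open>Y\<close> after \<open>X\<close>.\<close>

record ('k, 'o, 'm, 'c) linear_2cat =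
  Obj :: "'o set"
  Mor :: "'o \<Rightarrow> 'o \<Rightarrow> 'm set" ("\<B>\<index>")
  Hom :: "'m \<Rightarrow> 'm \<Rightarrow> ('k, 'c) module" ("\<H>\<index>")
  id1 :: "'o \<Rightarrow> 'm" ("\<I>\<index>")
  id2 :: "'m \<Rightarrow> 'c" ("\<iota>\<index>")
  vcomp :: "'c \<Rightarrow> 'c \<Rightarrow> 'c" (infixr "\<cdot>\<index>" 55)
  hcomp1 :: "'m \<Rightarrow> 'm \<Rightarrow> 'm" (infixr "\<star>\<index>" 70)
  hcomp2 :: "'c \<Rightarrow> 'c \<Rightarrow> 'c" (infixr "\<bullet>\<index>" 65)

locale linear_2category =
  fixes K :: "('k, 'r) ring_scheme"
    and B :: "('k, 'o, 'm, 'c, 'z) linear_2cat_scheme" (structure)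
  assumes field: "field K"
    and id1_mor: "\<alpha> \<in> Obj B \<Longrightarrow> \<I> \<alpha> \<in> \<B> \<alpha> \<alpha>"
    and hcomp1_mor: "\<lbrakk>\<alpha> \<in> Obj B; \<beta> \<in> Obj B; \<gamma> \<in> Obj B; X \<in> \<B> \<alpha> \<beta>; Y \<in> \<B> \<beta> \<gamma>\<rbrakk> \<Longrightarrow> Y \<star> X \<in> \<B> \<alpha> \<gamma>"
    and hcomp1_assoc: "\<lbrakk>\<alpha> \<in> Obj B; \<beta> \<in> Obj B; \<gamma> \<in> Obj B; \<delta> \<in> Obj B;
        X \<in> \<B> \<alpha> \<beta>; Y \<in> \<B> \<beta> \<gamma>; Z \<in> \<B> \<gamma> \<delta>\<rbrakk> \<Longrightarrow> (Z \<star> Y) \<star> X = Z \<star> (Y \<star> X)"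
    and hcomp1_unit_left: "\<lbrakk>\<alpha> \<in> Obj B; \<beta> \<in> Obj B; X \<in> \<B> \<alpha> \<beta>\<rbrakk> \<Longrightarrow> \<I> \<beta> \<star> X = X"
    and hcomp1_unit_right: "\<lbrakk>\<alpha> \<in> Obj B; \<beta> \<in> Obj B; X \<in> \<B> \<alpha> \<beta>\<rbrakk> \<Longrightarrow> X \<star> \<I> \<alpha> = X"
    and vector_space: "\<lbrakk>\<alpha> \<in> Obj B; \<beta> \<in> Obj B; X \<in> \<B> \<alpha> \<beta>; Y \<in> \<B> \<alpha> \<beta>\<rbrakk> \<Longrightarrow> module K (\<H> X Y)"
    and id2_hom: "\<lbrakk>\<alpha> \<in> Obj B; \<beta> \<in> Obj B; X \<in> \<B> \<alpha> \<beta>\<rbrakk> \<Longrightarrow> \<iota> X \<in> carrier (\<H> X X)"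
    and vcomp_linear_right: "\<lbrakk>\<alpha> \<in> Obj B; \<beta> \<in> Obj B; X \<in> \<B> \<alpha> \<beta>; Y \<in> \<B> \<alpha> \<beta>; Z \<in> \<B> \<alpha> \<beta>;
        \<Psi> \<in> carrier (\<H> Y Z)\<rbrakk> \<Longrightarrow> linear_map K (\<H> X Y) (\<H> X Z) (\<lambda>\<Phi>. \<Psi> \<cdot> \<Phi>)"
    and vcomp_linear_left: "\<lbrakk>\<alpha> \<in> Obj B; \<beta> \<in> Obj B; X \<in> \<B> \<alpha> \<beta>; Y \<in> \<B> \<alpha> \<beta>; Z \<in> \<B> \<alpha> \<beta>;
        \<Phi> \<in> carrier (\<H> X Y)\<rbrakk> \<Longrightarrow> linear_map K (\<H> Y Z) (\<H> X Z) (\<lambda>\<Psi>. \<Psi> \<cdot> \<Phi>)"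
    and vcomp_assoc: "\<lbrakk>\<alpha> \<in> Obj B; \<beta> \<in> Obj B;
        X \<in> \<B> \<alpha> \<beta>; Y \<in> \<B> \<alpha> \<beta>; Z \<in> \<B> \<alpha> \<beta>; W \<in> \<B> \<alpha> \<beta>;
        \<Phi> \<in> carrier (\<H> X Y); \<Psi> \<in> carrier (\<H> Y Z); \<Theta> \<in> carrier (\<H> Z W)\<rbrakk> \<Longrightarrow>
      (\<Theta> \<cdot> \<Psi>) \<cdot> \<Phi> = \<Theta> \<cdot> (\<Psi> \<cdot> \<Phi>)"
    and vcomp_unit_left: "\<lbrakk>\<alpha> \<in> Obj B; \<beta> \<in> Obj B; X \<in> \<B> \<alpha> \<beta>; Y \<in> \<B> \<alpha> \<beta>;
        \<Phi> \<in> carrier (\<H> X Y)\<rbrakk> \<Longrightarrow> \<iota> Y \<cdot> \<Phi> = \<Phi>"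
    and vcomp_unit_right: "\<lbrakk>\<alpha> \<in> Obj B; \<beta> \<in> Obj B; X \<in> \<B> \<alpha> \<beta>; Y \<in> \<B> \<alpha> \<beta>;
        \<Phi> \<in> carrier (\<H> X Y)\<rbrakk> \<Longrightarrow> \<Phi> \<cdot> \<iota> X = \<Phi>"
    and hcomp2_linear_right: "\<lbrakk>\<alpha> \<in> Obj B; \<beta> \<in> Obj B; \<gamma> \<in> Obj B;
        X \<in> \<B> \<alpha> \<beta>; X' \<in> \<B> \<alpha> \<beta>; Y \<in> \<B> \<beta> \<gamma>; Y' \<in> \<B> \<beta> \<gamma>; \<Psi> \<in> carrier (\<H> Y Y')\<rbrakk> \<Longrightarrow>
      linear_map K (\<H> X X') (\<H> (Y \<star> X) (Y' \<star> X')) (\<lambda>\<Phi>. \<Psi> \<bullet> \<Phi>)"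
    and hcomp2_linear_left: "\<lbrakk>\<alpha> \<in> Obj B; \<beta> \<in> Obj B; \<gamma> \<in> Obj B;
        X \<in> \<B> \<alpha> \<beta>; X' \<in> \<B> \<alpha> \<beta>; Y \<in> \<B> \<beta> \<gamma>; Y' \<in> \<B> \<beta> \<gamma>; \<Phi> \<in> carrier (\<H> X X')\<rbrakk> \<Longrightarrow>
      linear_map K (\<H> Y Y') (\<H> (Y \<star> X) (Y' \<star> X')) (\<lambda>\<Psi>. \<Psi> \<bullet> \<Phi>)"
    and hcomp2_assoc: "\<lbrakk>\<alpha> \<in> Obj B; \<beta> \<in> Obj B; \<gamma> \<in> Obj B; \<delta> \<in> Obj B;
        X \<in> \<B> \<alpha> \<beta>; X' \<in> \<B> \<alpha> \<beta>; Y \<in> \<B> \<beta> \<gamma>; Y' \<in> \<B> \<beta> \<gamma>; Z \<in> \<B> \<gamma> \<delta>; Z' \<in> \<B> \<gamma> \<delta>;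
        \<Phi> \<in> carrier (\<H> X X'); \<Psi> \<in> carrier (\<H> Y Y'); \<Theta> \<in> carrier (\<H> Z Z')\<rbrakk> \<Longrightarrow>
      (\<Theta> \<bullet> \<Psi>) \<bullet> \<Phi> = \<Theta> \<bullet> (\<Psi> \<bullet> \<Phi>)"
    and hcomp2_unit_left: "\<lbrakk>\<alpha> \<in> Obj B; \<beta> \<in> Obj B; X \<in> \<B> \<alpha> \<beta>; Y \<in> \<B> \<alpha> \<beta>;
        \<Phi> \<in> carrier (\<H> X Y)\<rbrakk> \<Longrightarrow> \<iota> (\<I> \<beta>) \<bullet> \<Phi> = \<Phi>"
    and hcomp2_unit_right: "\<lbrakk>\<alpha> \<in> Obj B; \<beta> \<in> Obj B; X \<in> \<B> \<alpha> \<beta>; Y \<in> \<B> \<alpha> \<beta>;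
        \<Phi> \<in> carrier (\<H> X Y)\<rbrakk> \<Longrightarrow> \<Phi> \<bullet> \<iota> (\<I> \<alpha>) = \<Phi>"
    and hcomp2_id2: "\<lbrakk>\<alpha> \<in> Obj B; \<beta> \<in> Obj B; \<gamma> \<in> Obj B; X \<in> \<B> \<alpha> \<beta>; Y \<in> \<B> \<beta> \<gamma>\<rbrakk> \<Longrightarrow>
      \<iota> Y \<bullet> \<iota> X = \<iota> (Y \<star> X)"
    and middle_four: "\<lbrakk>\<alpha> \<in> Obj B; \<beta> \<in> Obj B; \<gamma> \<in> Obj B;
        X \<in> \<B> \<alpha> \<beta>; X' \<in> \<B> \<alpha> \<beta>; X'' \<in> \<B> \<alpha> \<beta>; Y \<in> \<B> \<beta> \<gamma>; Y' \<in> \<B> \<beta> \<gamma>; Y'' \<in> \<B> \<beta> \<gamma>;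
        \<Phi> \<in> carrier (\<H> X X'); \<Phi>' \<in> carrier (\<H> X' X'');
        \<Psi> \<in> carrier (\<H> Y Y'); \<Psi>' \<in> carrier (\<H> Y' Y'')\<rbrakk> \<Longrightarrow>
      (\<Psi>' \<cdot> \<Psi>) \<bullet> (\<Phi>' \<cdot> \<Phi>) = (\<Psi>' \<bullet> \<Phi>') \<cdot> (\<Psi> \<bullet> \<Phi>)"

definition iso2 :: "('k, 'o, 'm, 'c, 'z) linear_2cat_scheme \<Rightarrow> 'm \<Rightarrow> 'm \<Rightarrow> 'c \<Rightarrow> bool"
  where "iso2 B X Y \<Phi> \<longleftrightarrow> \<Phi> \<in> carrier (Hom B X Y) \<and>
    (\<exists>\<Psi>\<in>carrier (Hom B Y X). \<Psi> \<cdot>\<^bsub>B\<^esub> \<Phi> = \<iota>\<^bsub>B\<^esub> X \<and> \<Phi> \<cdot>\<^bsub>B\<^esub> \<Psi> = \<iota>\<^bsub>B\<^esub> Y)"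

definition End_algebra :: "('k, 'o, 'm, 'c, 'z) linear_2cat_scheme \<Rightarrow> 'm \<Rightarrow> ('k, 'c) module"
  where "End_algebra B X = (Hom B X X)\<lparr>mult := vcomp B, one := id2 B X\<rparr>"

definition endo_monoidal_category ::
  "('k, 'o, 'm, 'c, 'z) linear_2cat_scheme \<Rightarrow> 'o \<Rightarrow> ('k, 'm, 'c) linear_monoidal_category"
  where "endo_monoidal_category B \<alpha> =
    \<lparr>MObj = Mor B \<alpha> \<alpha>, MHom = Hom B, Mid = id2 B, Mcomp = vcomp B,
      Munit = id1 B \<alpha>, Mtensor = hcomp1 B, Mtensor_hom = hcomp2 B,
      Massoc = (\<lambda>X Y Z. id2 B (hcomp1 B X (hcomp1 B Y Z))),
      Mlunit = id2 B, Mrunit = id2 B\<rparr>"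


section \<open>Pivotal 2-categories\<close>

text \<open>\<open>X\<dagger>\<close> is both the chosen left adjoint (with \<open>ev\<close>, \<open>coev\<close>) and the chosen right adjoint
  (with \<open>ev_tilde\<close>, \<open>coev_tilde\<close>) of \<open>X\<close>.\<close>

record ('k, 'o, 'm, 'c) pivotal_2cat = "('k, 'o, 'm, 'c) linear_2cat" +
  dagger :: "'m \<Rightarrow> 'm" ("_\<dagger>\<index>" [1000] 999)
  ev :: "'m \<Rightarrow> 'c"
  coev :: "'m \<Rightarrow> 'c"
  ev_tilde :: "'m \<Rightarrow> 'c"
  coev_tilde :: "'m \<Rightarrow> 'c"

text \<open>The canonical 2-morphism \<open>(Y \<otimes> X)\<dagger> \<rightarrow> X\<dagger> \<otimes> Y\<dagger>\<close> built from the right duals.\<close>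

definition dagger_comp :: "('k, 'o, 'm, 'c, 'z) pivotal_2cat_scheme \<Rightarrow> 'm \<Rightarrow> 'm \<Rightarrow> 'c"
  where "dagger_comp B Y X =
    (\<iota>\<^bsub>B\<^esub> (X\<dagger>\<^bsub>B\<^esub> \<star>\<^bsub>B\<^esub> Y\<dagger>\<^bsub>B\<^esub>) \<bullet>\<^bsub>B\<^esub> ev_tilde B (Y \<star>\<^bsub>B\<^esub> X)) \<cdot>\<^bsub>B\<^esub>
    (\<iota>\<^bsub>B\<^esub> (X\<dagger>\<^bsub>B\<^esub>) \<bullet>\<^bsub>B\<^esub> coev_tilde B Y \<bullet>\<^bsub>B\<^esub> \<iota>\<^bsub>B\<^esub> (X \<star>\<^bsub>B\<^esub> (Y \<star>\<^bsub>B\<^esub> X)\<dagger>\<^bsub>B\<^esub>)) \<cdot>\<^bsub>B\<^esub>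
    (coev_tilde B X \<bullet>\<^bsub>B\<^esub> \<iota>\<^bsub>B\<^esub> ((Y \<star>\<^bsub>B\<^esub> X)\<dagger>\<^bsub>B\<^esub>))"

locale linear_pivotal_2category = linear_2category K B
  for K :: "('k, 'r) ring_scheme"
    and B :: "('k, 'o, 'm, 'c, 'z) pivotal_2cat_scheme" (structure) +
  assumes dagger_mor: "\<lbrakk>\<alpha> \<in> Obj B; \<beta> \<in> Obj B; X \<in> \<B> \<alpha> \<beta>\<rbrakk> \<Longrightarrow> X\<dagger> \<in> \<B> \<beta> \<alpha>"
    and ev_hom: "\<lbrakk>\<alpha> \<in> Obj B; \<beta> \<in> Obj B; X \<in> \<B> \<alpha> \<beta>\<rbrakk> \<Longrightarrow> ev B X \<in> carrier (\<H> (X\<dagger> \<star> X) (\<I> \<alpha>))"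
    and coev_hom: "\<lbrakk>\<alpha> \<in> Obj B; \<beta> \<in> Obj B; X \<in> \<B> \<alpha> \<beta>\<rbrakk> \<Longrightarrow> coev B X \<in> carrier (\<H> (\<I> \<beta>) (X \<star> X\<dagger>))"
    and ev_tilde_hom: "\<lbrakk>\<alpha> \<in> Obj B; \<beta> \<in> Obj B; X \<in> \<B> \<alpha> \<beta>\<rbrakk> \<Longrightarrow>
      ev_tilde B X \<in> carrier (\<H> (X \<star> X\<dagger>) (\<I> \<beta>))"
    and coev_tilde_hom: "\<lbrakk>\<alpha> \<in> Obj B; \<beta> \<in> Obj B; X \<in> \<B> \<alpha> \<beta>\<rbrakk> \<Longrightarrow>
      coev_tilde B X \<in> carrier (\<H> (\<I> \<alpha>) (X\<dagger> \<star> X))"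
    and zigzag_left: "\<lbrakk>\<alpha> \<in> Obj B; \<beta> \<in> Obj B; X \<in> \<B> \<alpha> \<beta>\<rbrakk> \<Longrightarrow>
      (\<iota> X \<bullet> ev B X) \<cdot> (coev B X \<bullet> \<iota> X) = \<iota> X"
    and zigzag_left': "\<lbrakk>\<alpha> \<in> Obj B; \<beta> \<in> Obj B; X \<in> \<B> \<alpha> \<beta>\<rbrakk> \<Longrightarrow>
      (ev B X \<bullet> \<iota> (X\<dagger>)) \<cdot> (\<iota> (X\<dagger>) \<bullet> coev B X) = \<iota> (X\<dagger>)"
    and zigzag_right: "\<lbrakk>\<alpha> \<in> Obj B; \<beta> \<in> Obj B; X \<in> \<B> \<alpha> \<beta>\<rbrakk> \<Longrightarrow>
      (ev_tilde B X \<bullet> \<iota> X) \<cdot> (\<iota> X \<bullet> coev_tilde B X) = \<iota> X"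
    and zigzag_right': "\<lbrakk>\<alpha> \<in> Obj B; \<beta> \<in> Obj B; X \<in> \<B> \<alpha> \<beta>\<rbrakk> \<Longrightarrow>
      (\<iota> (X\<dagger>) \<bullet> ev_tilde B X) \<cdot> (coev_tilde B X \<bullet> \<iota> (X\<dagger>)) = \<iota> (X\<dagger>)"
    and pivotal_hom: "\<lbrakk>\<alpha> \<in> Obj B; \<beta> \<in> Obj B; X \<in> \<B> \<alpha> \<beta>; Z \<in> \<B> \<alpha> \<beta>; \<Phi> \<in> carrier (\<H> X Z)\<rbrakk> \<Longrightarrow>
      (ev B Z \<bullet> \<iota> (X\<dagger>)) \<cdot> (\<iota> (Z\<dagger>) \<bullet> \<Phi> \<bullet> \<iota> (X\<dagger>)) \<cdot> (\<iota> (Z\<dagger>) \<bullet> coev B X) =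
      (\<iota> (X\<dagger>) \<bullet> ev_tilde B Z) \<cdot> (\<iota> (X\<dagger>) \<bullet> \<Phi> \<bullet> \<iota> (Z\<dagger>)) \<cdot> (coev_tilde B X \<bullet> \<iota> (Z\<dagger>))"
    and pivotal_comp: "\<lbrakk>\<alpha> \<in> Obj B; \<beta> \<in> Obj B; \<gamma> \<in> Obj B; X \<in> \<B> \<alpha> \<beta>; Y \<in> \<B> \<beta> \<gamma>\<rbrakk> \<Longrightarrow>
      dagger_comp B Y X =
      (ev B (Y \<star> X) \<bullet> \<iota> (X\<dagger> \<star> Y\<dagger>)) \<cdot>
      (\<iota> ((Y \<star> X)\<dagger> \<star> Y) \<bullet> coev B X \<bullet> \<iota> (Y\<dagger>)) \<cdot>
      (\<iota> ((Y \<star> X)\<dagger>) \<bullet> coev B Y)"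


section \<open>Monoidal 2-categories with duals\<close>

text \<open>The data of a Gray category with duals with a single object. The action of \<open>\<alpha> \<box> (-)\<close> on 1-
  and 2-morphisms is written \<open>\<alpha> \<triangleright> X\<close> and \<open>\<alpha> \<unrhd> \<Phi>\<close>, that of \<open>(-) \<box> \<alpha>\<close> is \<open>X \<triangleleft> \<alpha>\<close> and \<open>\<Phi> \<unlhd> \<alpha>\<close>.
  For \<open>X : \<alpha> \<rightarrow> \<alpha>'\<close> and \<open>Y : \<beta> \<rightarrow> \<beta>'\<close>, \<open>\<sigma> X Y\<close> is the interchange 2-morphism
  \<open>(X \<triangleleft> \<beta>') \<star> (\<alpha> \<triangleright> Y) \<rightarrow> (\<alpha>' \<triangleright> Y) \<star> (X \<triangleleft> \<beta>)\<close>.\<close>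

record ('k, 'o, 'm, 'c) monoidal_2cat = "('k, 'o, 'm, 'c) pivotal_2cat" +
  unit_obj :: "'o" ("\<O>\<index>")
  box :: "'o \<Rightarrow> 'o \<Rightarrow> 'o" (infixl "\<box>\<index>" 75)
  lwhisker1 :: "'o \<Rightarrow> 'm \<Rightarrow> 'm" (infix "\<triangleright>\<index>" 80)
  rwhisker1 :: "'m \<Rightarrow> 'o \<Rightarrow> 'm" (infix "\<triangleleft>\<index>" 80)
  lwhisker2 :: "'o \<Rightarrow> 'c \<Rightarrow> 'c" (infix "\<unrhd>\<index>" 80)
  rwhisker2 :: "'c \<Rightarrow> 'o \<Rightarrow> 'c" (infix "\<unlhd>\<index>" 80)
  interchange :: "'m \<Rightarrow> 'm \<Rightarrow> 'c" ("\<sigma>\<index>")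
  dual :: "'o \<Rightarrow> 'o" ("_\<sharp>\<index>" [1000] 999)
  fold1 :: "'o \<Rightarrow> 'm" ("\<eta>\<index>")
  triangulator :: "'o \<Rightarrow> 'c" ("\<T>\<index>")

text \<open>The mate of the triangulator \<open>\<T> \<alpha> : (\<eta>\<^sub>\<alpha>\<dagger> \<box> \<alpha>) \<otimes> (\<alpha> \<box> \<eta>\<^sub>\<alpha>\<^sub>\<sharp>) \<rightarrow> 1\<^sub>\<alpha>\<close>, a 2-morphism
  \<open>1\<^sub>\<alpha> \<rightarrow> (\<alpha> \<box> \<eta>\<^sub>\<alpha>\<^sub>\<sharp>\<dagger>) \<otimes> (\<eta>\<^sub>\<alpha> \<box> \<alpha>)\<close>. If \<open>\<dagger>\<close> is a strict involution with \<open>(Y \<otimes> X)\<dagger> = X\<dagger> \<otimes> Y\<dagger>\<close>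
  and \<open>coev_tilde\<close> of \<open>\<eta>\<dagger>\<close> is \<open>coev\<close> of \<open>\<eta>\<close>, as in a Gray category with duals, this is the dual
  2-morphism \<open>(\<T> \<alpha>)\<dagger>\<close>.\<close>

definition triangulator_mate :: "('k, 'o, 'm, 'c, 'z) monoidal_2cat_scheme \<Rightarrow> 'o \<Rightarrow> 'c"
  where "triangulator_mate B \<alpha> =
    (\<iota>\<^bsub>B\<^esub> ((\<alpha> \<triangleright>\<^bsub>B\<^esub> (\<eta>\<^bsub>B\<^esub> (\<alpha>\<sharp>\<^bsub>B\<^esub>))\<dagger>\<^bsub>B\<^esub>) \<star>\<^bsub>B\<^esub> (\<eta>\<^bsub>B\<^esub> \<alpha> \<triangleleft>\<^bsub>B\<^esub> \<alpha>)) \<bullet>\<^bsub>B\<^esub> \<T>\<^bsub>B\<^esub> \<alpha>) \<cdot>\<^bsub>B\<^esub>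
    (\<iota>\<^bsub>B\<^esub> (\<alpha> \<triangleright>\<^bsub>B\<^esub> (\<eta>\<^bsub>B\<^esub> (\<alpha>\<sharp>\<^bsub>B\<^esub>))\<dagger>\<^bsub>B\<^esub>) \<bullet>\<^bsub>B\<^esub> (coev B (\<eta>\<^bsub>B\<^esub> \<alpha>) \<unlhd>\<^bsub>B\<^esub> \<alpha>)
      \<bullet>\<^bsub>B\<^esub> \<iota>\<^bsub>B\<^esub> (\<alpha> \<triangleright>\<^bsub>B\<^esub> \<eta>\<^bsub>B\<^esub> (\<alpha>\<sharp>\<^bsub>B\<^esub>))) \<cdot>\<^bsub>B\<^esub>
    (\<alpha> \<unrhd>\<^bsub>B\<^esub> coev_tilde B (\<eta>\<^bsub>B\<^esub> (\<alpha>\<sharp>\<^bsub>B\<^esub>)))"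

text \<open>The functors \<open>\<alpha> \<box> (-)\<close> and \<open>(-) \<box> \<alpha>\<close> are strict \<open>K\<close>-linear pivotal 2-functors. In
  \<open>triangulator_box\<close> and \<open>triangulator_unit\<close> the canonical 2-morphisms \<open>(Y \<otimes> X)\<dagger> \<rightarrow> X\<dagger> \<otimes> Y\<dagger>\<close>
  and \<open>1\<dagger> \<rightarrow> 1\<close> (the latter being \<open>ev\<^sub>1\<close>) are inserted because \<open>\<dagger>\<close> is not assumed to be strictly
  functorial; for a strictly pivotal \<open>B\<close> both are identities.\<close>

locale monoidal_2category_with_duals = linear_pivotal_2category K B
  for K :: "('k, 'r) ring_scheme"
    and B :: "('k, 'o, 'm, 'c, 'z) monoidal_2cat_scheme" (structure) +
  assumes unit_obj: "\<O> \<in> Obj B"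
    and box_obj: "\<lbrakk>\<alpha> \<in> Obj B; \<beta> \<in> Obj B\<rbrakk> \<Longrightarrow> \<alpha> \<box> \<beta> \<in> Obj B"
    and box_assoc: "\<lbrakk>\<alpha> \<in> Obj B; \<beta> \<in> Obj B; \<gamma> \<in> Obj B\<rbrakk> \<Longrightarrow> (\<alpha> \<box> \<beta>) \<box> \<gamma> = \<alpha> \<box> (\<beta> \<box> \<gamma>)"
    and box_unit_left: "\<alpha> \<in> Obj B \<Longrightarrow> \<O> \<box> \<alpha> = \<alpha>"
    and box_unit_right: "\<alpha> \<in> Obj B \<Longrightarrow> \<alpha> \<box> \<O> = \<alpha>"
    \<comment> \<open>\<open>\<gamma> \<box> (-)\<close> is a strict linear 2-functor preserving the pivotal structure\<close>
    and lwhisker1_mor: "\<lbrakk>\<gamma> \<in> Obj B; \<alpha> \<in> Obj B; \<beta> \<in> Obj B; X \<in> \<B> \<alpha> \<beta>\<rbrakk> \<Longrightarrow>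
      \<gamma> \<triangleright> X \<in> \<B> (\<gamma> \<box> \<alpha>) (\<gamma> \<box> \<beta>)"
    and lwhisker1_id1: "\<lbrakk>\<gamma> \<in> Obj B; \<alpha> \<in> Obj B\<rbrakk> \<Longrightarrow> \<gamma> \<triangleright> \<I> \<alpha> = \<I> (\<gamma> \<box> \<alpha>)"
    and lwhisker1_hcomp1: "\<lbrakk>\<delta> \<in> Obj B; \<alpha> \<in> Obj B; \<beta> \<in> Obj B; \<gamma> \<in> Obj B; X \<in> \<B> \<alpha> \<beta>; Y \<in> \<B> \<beta> \<gamma>\<rbrakk> \<Longrightarrow>
      \<delta> \<triangleright> (Y \<star> X) = (\<delta> \<triangleright> Y) \<star> (\<delta> \<triangleright> X)"
    and lwhisker2_linear: "\<lbrakk>\<gamma> \<in> Obj B; \<alpha> \<in> Obj B; \<beta> \<in> Obj B; X \<in> \<B> \<alpha> \<beta>; Y \<in> \<B> \<alpha> \<beta>\<rbrakk> \<Longrightarrow>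
      linear_map K (\<H> X Y) (\<H> (\<gamma> \<triangleright> X) (\<gamma> \<triangleright> Y)) (\<lambda>\<Phi>. \<gamma> \<unrhd> \<Phi>)"
    and lwhisker2_id2: "\<lbrakk>\<gamma> \<in> Obj B; \<alpha> \<in> Obj B; \<beta> \<in> Obj B; X \<in> \<B> \<alpha> \<beta>\<rbrakk> \<Longrightarrow> \<gamma> \<unrhd> \<iota> X = \<iota> (\<gamma> \<triangleright> X)"
    and lwhisker2_vcomp: "\<lbrakk>\<gamma> \<in> Obj B; \<alpha> \<in> Obj B; \<beta> \<in> Obj B; X \<in> \<B> \<alpha> \<beta>; Y \<in> \<B> \<alpha> \<beta>; Z \<in> \<B> \<alpha> \<beta>;
        \<Phi> \<in> carrier (\<H> X Y); \<Psi> \<in> carrier (\<H> Y Z)\<rbrakk> \<Longrightarrow> \<gamma> \<unrhd> (\<Psi> \<cdot> \<Phi>) = (\<gamma> \<unrhd> \<Psi>) \<cdot> (\<gamma> \<unrhd> \<Phi>)"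
    and lwhisker2_hcomp2: "\<lbrakk>\<delta> \<in> Obj B; \<alpha> \<in> Obj B; \<beta> \<in> Obj B; \<gamma> \<in> Obj B;
        X \<in> \<B> \<alpha> \<beta>; X' \<in> \<B> \<alpha> \<beta>; Y \<in> \<B> \<beta> \<gamma>; Y' \<in> \<B> \<beta> \<gamma>;
        \<Phi> \<in> carrier (\<H> X X'); \<Psi> \<in> carrier (\<H> Y Y')\<rbrakk> \<Longrightarrow> \<delta> \<unrhd> (\<Psi> \<bullet> \<Phi>) = (\<delta> \<unrhd> \<Psi>) \<bullet> (\<delta> \<unrhd> \<Phi>)"
    and lwhisker_pivotal: "\<lbrakk>\<gamma> \<in> Obj B; \<alpha> \<in> Obj B; \<beta> \<in> Obj B; X \<in> \<B> \<alpha> \<beta>\<rbrakk> \<Longrightarrow>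
      (\<gamma> \<triangleright> X)\<dagger> = \<gamma> \<triangleright> X\<dagger> \<and>
      ev B (\<gamma> \<triangleright> X) = \<gamma> \<unrhd> ev B X \<and> coev B (\<gamma> \<triangleright> X) = \<gamma> \<unrhd> coev B X \<and>
      ev_tilde B (\<gamma> \<triangleright> X) = \<gamma> \<unrhd> ev_tilde B X \<and> coev_tilde B (\<gamma> \<triangleright> X) = \<gamma> \<unrhd> coev_tilde B X"
    \<comment> \<open>\<open>(-) \<box> \<gamma>\<close> is a strict linear 2-functor preserving the pivotal structure\<close>
    and rwhisker1_mor: "\<lbrakk>\<gamma> \<in> Obj B; \<alpha> \<in> Obj B; \<beta> \<in> Obj B; X \<in> \<B> \<alpha> \<beta>\<rbrakk> \<Longrightarrow>
      X \<triangleleft> \<gamma> \<in> \<B> (\<alpha> \<box> \<gamma>) (\<beta> \<box> \<gamma>)"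
    and rwhisker1_id1: "\<lbrakk>\<gamma> \<in> Obj B; \<alpha> \<in> Obj B\<rbrakk> \<Longrightarrow> \<I> \<alpha> \<triangleleft> \<gamma> = \<I> (\<alpha> \<box> \<gamma>)"
    and rwhisker1_hcomp1: "\<lbrakk>\<delta> \<in> Obj B; \<alpha> \<in> Obj B; \<beta> \<in> Obj B; \<gamma> \<in> Obj B; X \<in> \<B> \<alpha> \<beta>; Y \<in> \<B> \<beta> \<gamma>\<rbrakk> \<Longrightarrow>
      (Y \<star> X) \<triangleleft> \<delta> = (Y \<triangleleft> \<delta>) \<star> (X \<triangleleft> \<delta>)"
    and rwhisker2_linear: "\<lbrakk>\<gamma> \<in> Obj B; \<alpha> \<in> Obj B; \<beta> \<in> Obj B; X \<in> \<B> \<alpha> \<beta>; Y \<in> \<B> \<alpha> \<beta>\<rbrakk> \<Longrightarrow>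
      linear_map K (\<H> X Y) (\<H> (X \<triangleleft> \<gamma>) (Y \<triangleleft> \<gamma>)) (\<lambda>\<Phi>. \<Phi> \<unlhd> \<gamma>)"
    and rwhisker2_id2: "\<lbrakk>\<gamma> \<in> Obj B; \<alpha> \<in> Obj B; \<beta> \<in> Obj B; X \<in> \<B> \<alpha> \<beta>\<rbrakk> \<Longrightarrow> \<iota> X \<unlhd> \<gamma> = \<iota> (X \<triangleleft> \<gamma>)"
    and rwhisker2_vcomp: "\<lbrakk>\<gamma> \<in> Obj B; \<alpha> \<in> Obj B; \<beta> \<in> Obj B; X \<in> \<B> \<alpha> \<beta>; Y \<in> \<B> \<alpha> \<beta>; Z \<in> \<B> \<alpha> \<beta>;
        \<Phi> \<in> carrier (\<H> X Y); \<Psi> \<in> carrier (\<H> Y Z)\<rbrakk> \<Longrightarrow> (\<Psi> \<cdot> \<Phi>) \<unlhd> \<gamma> = (\<Psi> \<unlhd> \<gamma>) \<cdot> (\<Phi> \<unlhd> \<gamma>)"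
    and rwhisker2_hcomp2: "\<lbrakk>\<delta> \<in> Obj B; \<alpha> \<in> Obj B; \<beta> \<in> Obj B; \<gamma> \<in> Obj B;
        X \<in> \<B> \<alpha> \<beta>; X' \<in> \<B> \<alpha> \<beta>; Y \<in> \<B> \<beta> \<gamma>; Y' \<in> \<B> \<beta> \<gamma>;
        \<Phi> \<in> carrier (\<H> X X'); \<Psi> \<in> carrier (\<H> Y Y')\<rbrakk> \<Longrightarrow> (\<Psi> \<bullet> \<Phi>) \<unlhd> \<delta> = (\<Psi> \<unlhd> \<delta>) \<bullet> (\<Phi> \<unlhd> \<delta>)"
    and rwhisker_pivotal: "\<lbrakk>\<gamma> \<in> Obj B; \<alpha> \<in> Obj B; \<beta> \<in> Obj B; X \<in> \<B> \<alpha> \<beta>\<rbrakk> \<Longrightarrow>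
      (X \<triangleleft> \<gamma>)\<dagger> = X\<dagger> \<triangleleft> \<gamma> \<and>
      ev B (X \<triangleleft> \<gamma>) = ev B X \<unlhd> \<gamma> \<and> coev B (X \<triangleleft> \<gamma>) = coev B X \<unlhd> \<gamma> \<and>
      ev_tilde B (X \<triangleleft> \<gamma>) = ev_tilde B X \<unlhd> \<gamma> \<and> coev_tilde B (X \<triangleleft> \<gamma>) = coev_tilde B X \<unlhd> \<gamma>"
    \<comment> \<open>strict associativity and unitality of the 2-functors\<close>
    and whisker1_assoc: "\<lbrakk>\<gamma> \<in> Obj B; \<delta> \<in> Obj B; \<alpha> \<in> Obj B; \<beta> \<in> Obj B; X \<in> \<B> \<alpha> \<beta>\<rbrakk> \<Longrightarrow>
      (\<gamma> \<box> \<delta>) \<triangleright> X = \<gamma> \<triangleright> (\<delta> \<triangleright> X) \<and> X \<triangleleft> (\<gamma> \<box> \<delta>) = (X \<triangleleft> \<gamma>) \<triangleleft> \<delta> \<and>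
      (\<gamma> \<triangleright> X) \<triangleleft> \<delta> = \<gamma> \<triangleright> (X \<triangleleft> \<delta>)"
    and whisker1_unit: "\<lbrakk>\<alpha> \<in> Obj B; \<beta> \<in> Obj B; X \<in> \<B> \<alpha> \<beta>\<rbrakk> \<Longrightarrow> \<O> \<triangleright> X = X \<and> X \<triangleleft> \<O> = X"
    and whisker2_assoc: "\<lbrakk>\<gamma> \<in> Obj B; \<delta> \<in> Obj B; \<alpha> \<in> Obj B; \<beta> \<in> Obj B; X \<in> \<B> \<alpha> \<beta>; Y \<in> \<B> \<alpha> \<beta>;
        \<Phi> \<in> carrier (\<H> X Y)\<rbrakk> \<Longrightarrow>
      (\<gamma> \<box> \<delta>) \<unrhd> \<Phi> = \<gamma> \<unrhd> (\<delta> \<unrhd> \<Phi>) \<and> \<Phi> \<unlhd> (\<gamma> \<box> \<delta>) = (\<Phi> \<unlhd> \<gamma>) \<unlhd> \<delta> \<and>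
      (\<gamma> \<unrhd> \<Phi>) \<unlhd> \<delta> = \<gamma> \<unrhd> (\<Phi> \<unlhd> \<delta>)"
    and whisker2_unit: "\<lbrakk>\<alpha> \<in> Obj B; \<beta> \<in> Obj B; X \<in> \<B> \<alpha> \<beta>; Y \<in> \<B> \<alpha> \<beta>; \<Phi> \<in> carrier (\<H> X Y)\<rbrakk> \<Longrightarrow>
      \<O> \<unrhd> \<Phi> = \<Phi> \<and> \<Phi> \<unlhd> \<O> = \<Phi>"
    \<comment> \<open>the interchange 2-morphisms\<close>
    and interchange_iso: "\<lbrakk>\<alpha> \<in> Obj B; \<alpha>' \<in> Obj B; \<beta> \<in> Obj B; \<beta>' \<in> Obj B; X \<in> \<B> \<alpha> \<alpha>'; Y \<in> \<B> \<beta> \<beta>'\<rbrakk> \<Longrightarrow>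
      iso2 B ((X \<triangleleft> \<beta>') \<star> (\<alpha> \<triangleright> Y)) ((\<alpha>' \<triangleright> Y) \<star> (X \<triangleleft> \<beta>)) (\<sigma> X Y)"
    and interchange_natural: "\<lbrakk>\<alpha> \<in> Obj B; \<alpha>' \<in> Obj B; \<beta> \<in> Obj B; \<beta>' \<in> Obj B;
        X \<in> \<B> \<alpha> \<alpha>'; X' \<in> \<B> \<alpha> \<alpha>'; Y \<in> \<B> \<beta> \<beta>'; Y' \<in> \<B> \<beta> \<beta>';
        \<Phi> \<in> carrier (\<H> X X'); \<Psi> \<in> carrier (\<H> Y Y')\<rbrakk> \<Longrightarrow>
      \<sigma> X' Y' \<cdot> ((\<Phi> \<unlhd> \<beta>') \<bullet> (\<alpha> \<unrhd> \<Psi>)) = ((\<alpha>' \<unrhd> \<Psi>) \<bullet> (\<Phi> \<unlhd> \<beta>)) \<cdot> \<sigma> X Y"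
    and interchange_id_left: "\<lbrakk>\<alpha> \<in> Obj B; \<beta> \<in> Obj B; \<beta>' \<in> Obj B; Y \<in> \<B> \<beta> \<beta>'\<rbrakk> \<Longrightarrow>
      \<sigma> (\<I> \<alpha>) Y = \<iota> (\<alpha> \<triangleright> Y)"
    and interchange_id_right: "\<lbrakk>\<alpha> \<in> Obj B; \<alpha>' \<in> Obj B; \<beta> \<in> Obj B; X \<in> \<B> \<alpha> \<alpha>'\<rbrakk> \<Longrightarrow>
      \<sigma> X (\<I> \<beta>) = \<iota> (X \<triangleleft> \<beta>)"
    and interchange_hcomp1_left: "\<lbrakk>\<alpha> \<in> Obj B; \<alpha>' \<in> Obj B; \<alpha>'' \<in> Obj B; \<beta> \<in> Obj B; \<beta>' \<in> Obj B;
        X \<in> \<B> \<alpha> \<alpha>'; X' \<in> \<B> \<alpha>' \<alpha>''; Y \<in> \<B> \<beta> \<beta>'\<rbrakk> \<Longrightarrow>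
      \<sigma> (X' \<star> X) Y = (\<sigma> X' Y \<bullet> \<iota> (X \<triangleleft> \<beta>)) \<cdot> (\<iota> (X' \<triangleleft> \<beta>') \<bullet> \<sigma> X Y)"
    and interchange_hcomp1_right: "\<lbrakk>\<alpha> \<in> Obj B; \<alpha>' \<in> Obj B; \<beta> \<in> Obj B; \<beta>' \<in> Obj B; \<beta>'' \<in> Obj B;
        X \<in> \<B> \<alpha> \<alpha>'; Y \<in> \<B> \<beta> \<beta>'; Y' \<in> \<B> \<beta>' \<beta>''\<rbrakk> \<Longrightarrow>
      \<sigma> X (Y' \<star> Y) = (\<iota> (\<alpha>' \<triangleright> Y') \<bullet> \<sigma> X Y) \<cdot> (\<sigma> X Y' \<bullet> \<iota> (\<alpha> \<triangleright> Y))"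
    and interchange_whisker: "\<lbrakk>\<alpha> \<in> Obj B; \<alpha>' \<in> Obj B; \<beta> \<in> Obj B; \<beta>' \<in> Obj B; \<gamma> \<in> Obj B;
        X \<in> \<B> \<alpha> \<alpha>'; Y \<in> \<B> \<beta> \<beta>'\<rbrakk> \<Longrightarrow>
      \<sigma> (\<gamma> \<triangleright> X) Y = \<gamma> \<unrhd> \<sigma> X Y \<and> \<sigma> (X \<triangleleft> \<gamma>) Y = \<sigma> X (\<gamma> \<triangleright> Y) \<and> \<sigma> X (Y \<triangleleft> \<gamma>) = \<sigma> X Y \<unlhd> \<gamma>"
    \<comment> \<open>duals of objects, folds and triangulators\<close>
    and dual_obj: "\<alpha> \<in> Obj B \<Longrightarrow> \<alpha>\<sharp> \<in> Obj B"
    and dual_dual: "\<alpha> \<in> Obj B \<Longrightarrow> (\<alpha>\<sharp>)\<sharp> = \<alpha>"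
    and dual_unit: "\<O>\<sharp> = \<O>"
    and dual_box: "\<lbrakk>\<alpha> \<in> Obj B; \<beta> \<in> Obj B\<rbrakk> \<Longrightarrow> (\<alpha> \<box> \<beta>)\<sharp> = \<beta>\<sharp> \<box> \<alpha>\<sharp>"
    and fold_mor: "\<alpha> \<in> Obj B \<Longrightarrow> \<eta> \<alpha> \<in> \<B> \<O> (\<alpha> \<box> \<alpha>\<sharp>)"
    and fold_unit: "\<eta> \<O> = \<I> \<O>"
    and fold_box: "\<lbrakk>\<alpha> \<in> Obj B; \<beta> \<in> Obj B\<rbrakk> \<Longrightarrow> \<eta> (\<alpha> \<box> \<beta>) = (\<alpha> \<triangleright> (\<eta> \<beta> \<triangleleft> \<alpha>\<sharp>)) \<star> \<eta> \<alpha>"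
    and triangulator_iso: "\<alpha> \<in> Obj B \<Longrightarrow>
      iso2 B (((\<eta> \<alpha>)\<dagger> \<triangleleft> \<alpha>) \<star> (\<alpha> \<triangleright> \<eta> (\<alpha>\<sharp>))) (\<I> \<alpha>) (\<T> \<alpha>)"
    and triangulator_unit: "\<T> \<O> = ev B (\<I> \<O>)"
    and triangulator_box: "\<lbrakk>\<alpha> \<in> Obj B; \<beta> \<in> Obj B\<rbrakk> \<Longrightarrow>
      \<T> (\<alpha> \<box> \<beta>) =
      ((\<T> \<alpha> \<unlhd> \<beta>) \<bullet> (\<alpha> \<unrhd> \<T> \<beta>)) \<cdot>
      (\<iota> ((\<eta> \<alpha>)\<dagger> \<triangleleft> (\<alpha> \<box> \<beta>)) \<bullet> (\<alpha> \<unrhd> (\<sigma> ((\<eta> \<beta>)\<dagger>) (\<eta> (\<alpha>\<sharp>)) \<unlhd> \<beta>)) \<bullet> \<iota> ((\<alpha> \<box> \<beta>) \<triangleright> \<eta> (\<beta>\<sharp>))) \<cdot>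
      ((dagger_comp B (\<alpha> \<triangleright> (\<eta> \<beta> \<triangleleft> \<alpha>\<sharp>)) (\<eta> \<alpha>) \<unlhd> (\<alpha> \<box> \<beta>)) \<bullet> \<iota> ((\<alpha> \<box> \<beta>) \<triangleright> \<eta> ((\<alpha> \<box> \<beta>)\<sharp>)))"
    and swallowtail: "\<alpha> \<in> Obj B \<Longrightarrow>
      (\<iota> ((\<eta> \<alpha>)\<dagger>) \<bullet> (\<T> \<alpha> \<unlhd> \<alpha>\<sharp>)) \<cdot>
      (\<sigma> ((\<eta> \<alpha>)\<dagger>) ((\<eta> \<alpha>)\<dagger>) \<bullet> \<iota> (\<alpha> \<triangleright> (\<eta> (\<alpha>\<sharp>) \<triangleleft> \<alpha>\<sharp>))) \<cdot>
      (\<iota> ((\<eta> \<alpha>)\<dagger>) \<bullet> (\<alpha> \<unrhd> triangulator_mate B (\<alpha>\<sharp>))) =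
      \<iota> ((\<eta> \<alpha>)\<dagger>)"

text \<open>The equivalence \<open>\<B> \<alpha> \<beta> \<rightarrow> \<B> \<O> (\<beta> \<box> \<alpha>\<sharp>)\<close>, \<open>X \<mapsto> (X \<box> \<alpha>\<sharp>) \<otimes> \<eta>\<^sub>\<alpha>\<close>, given by duality, on
  1-morphisms and 2-morphisms.\<close>

definition tilde1 :: "('k, 'o, 'm, 'c, 'z) monoidal_2cat_scheme \<Rightarrow> 'o \<Rightarrow> 'm \<Rightarrow> 'm"
  where "tilde1 B \<alpha> X = (X \<triangleleft>\<^bsub>B\<^esub> \<alpha>\<sharp>\<^bsub>B\<^esub>) \<star>\<^bsub>B\<^esub> \<eta>\<^bsub>B\<^esub> \<alpha>"

definition tilde2 :: "('k, 'o, 'm, 'c, 'z) monoidal_2cat_scheme \<Rightarrow> 'o \<Rightarrow> 'c \<Rightarrow> 'c"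
  where "tilde2 B \<alpha> \<Phi> = (\<Phi> \<unlhd>\<^bsub>B\<^esub> \<alpha>\<sharp>\<^bsub>B\<^esub>) \<bullet>\<^bsub>B\<^esub> \<iota>\<^bsub>B\<^esub> (\<eta>\<^bsub>B\<^esub> \<alpha>)"

text \<open>The pairing with values in \<open>End(1\<^sub>\<O>)\<close>.\<close>

definition End_pairing :: "('k, 'o, 'm, 'c, 'z) monoidal_2cat_scheme \<Rightarrow> 'o \<Rightarrow> 'c \<Rightarrow> 'c \<Rightarrow> 'c"
  where "End_pairing B \<alpha> \<phi>\<^sub>1 \<phi>\<^sub>2 =
    (let u = tilde1 B \<alpha> (\<I>\<^bsub>B\<^esub> \<alpha>) in
      ev B u \<cdot>\<^bsub>B\<^esub> (\<iota>\<^bsub>B\<^esub> (u\<dagger>\<^bsub>B\<^esub>) \<bullet>\<^bsub>B\<^esub> (tilde2 B \<alpha> \<phi>\<^sub>1 \<cdot>\<^bsub>B\<^esub> tilde2 B \<alpha> \<phi>\<^sub>2)) \<cdot>\<^bsub>B\<^esub> coev_tilde B u)"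

text \<open>The map \<open>K \<rightarrow> End(1\<^sub>\<O>)\<close>, \<open>c \<mapsto> c \<cdot> id\<close>, and its inverse (meaningful when this map is
  bijective).\<close>

definition unit_scalar :: "('k, 'o, 'm, 'c, 'z) monoidal_2cat_scheme \<Rightarrow> 'k \<Rightarrow> 'c"
  where "unit_scalar B c = c \<odot>\<^bsub>Hom B (\<I>\<^bsub>B\<^esub> \<O>\<^bsub>B\<^esub>) (\<I>\<^bsub>B\<^esub> \<O>\<^bsub>B\<^esub>)\<^esub> \<iota>\<^bsub>B\<^esub> (\<I>\<^bsub>B\<^esub> \<O>\<^bsub>B\<^esub>)"

definition scalar_of :: "('k, 'r) ring_scheme \<Rightarrow> ('k, 'o, 'm, 'c, 'z) monoidal_2cat_scheme \<Rightarrow> 'c \<Rightarrow> 'k"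
  where "scalar_of K B = the_inv_into (carrier K) (unit_scalar B)"

end

theory Submission
  imports Defs
begin

text \<open>Write \<open>\<eta>\<close> for the fold of \<open>\<alpha>\<close> and \<open>V = \<eta>\<dagger> \<otimes> \<eta> \<in> \<B>(\<O>, \<O>)\<close>. The triangulator and the swallowtail identity
  show that \<open>\<phi> \<mapsto> 1 \<otimes> (\<phi> \<box> \<alpha>\<sharp>)\<close> is a bijection from \<open>End(1\<^sub>\<alpha>)\<close> onto \<open>End(\<eta>\<dagger>)\<close>, and the adjunctions between \<open>\<eta>\<close>
  and \<open>\<eta>\<dagger>\<close> identify \<open>End(\<eta>\<dagger>)\<close> with \<open>Hom(1, V)\<close> and with \<open>Hom(V, 1)\<close>. Under these identifications the
  pairing is the composition \<open>Hom(V, 1) \<times> Hom(1, V) \<rightarrow> End(1)\<close>, which is nondegenerate, and \<open>Hom(1, V)\<close> is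
  finite-dimensional, because both hold in the category of vector spaces. Commutativity of
  \<open>End(1\<^sub>\<alpha>)\<close> is the Eckmann-Hilton argument.\<close>

section \<open>Linear maps and dimension\<close>

text \<open>Injectivity of \<open>cofold_End\<close> rests on the invertibility of the triangulator
  and on naturality of the interchange at an identity; surjectivity is where the swallowtail
  identity enters. Surjectivity matters because a 2-morphism V -> 1 is shown to vanish by composing
  it with every element of Hom(1, V), so each of these has to come from some element of
  End(1_\<alpha>). The passage from End(\<eta>) to End(\<eta>\<dagger>) is an associativity: 1
  \<otimes> ((\<phi> \<box> \<alpha>\<sharp>) \<otimes> 1) on \<eta>\<dagger> \<otimes> \<eta> is
  \<open>cofold_End \<alpha> \<phi>\<close> whiskered with \<eta>. The left adjunction
  (\<open>ev\<close>) then gives Hom(V, 1) and the right one (\<open>coev_tilde\<close>) gives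
  Hom(1, V), exactly the two cups and caps of the pairing. On the side of vector spaces, the image
  of the unit object is a line. Evaluating \<open>F\<^sub>1\<close> of a morphism 1 -> X at a basis
  vector of this line identifies Hom(1, X) with the space \<open>F\<^sub>0 X\<close>, compatibly
  with composition. This gives the dimension bound, and it shows that a morphism out of V is
  determined by its composites with Hom(1, V).\<close>

lemma linear_mapI:
  assumes "\<And>x. x \<in> carrier M \<Longrightarrow> f x \<in> carrier N"
    and "\<And>x y. \<lbrakk>x \<in> carrier M; y \<in> carrier M\<rbrakk> \<Longrightarrow> f (x \<oplus>\<^bsub>M\<^esub> y) = f x \<oplus>\<^bsub>N\<^esub> f y"
    and "\<And>c x. \<lbrakk>c \<in> carrier K; x \<in> carrier M\<rbrakk> \<Longrightarrow> f (c \<odot>\<^bsub>M\<^esub> x) = c \<odot>\<^bsub>N\<^esub> f x"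
  shows "linear_map K M N f"
  using assms by (auto simp: linear_map_def)

lemma linear_map_closed: "\<lbrakk>linear_map K M N f; x \<in> carrier M\<rbrakk> \<Longrightarrow> f x \<in> carrier N"
  and linear_map_add: "\<lbrakk>linear_map K M N f; x \<in> carrier M; y \<in> carrier M\<rbrakk> \<Longrightarrow>
    f (x \<oplus>\<^bsub>M\<^esub> y) = f x \<oplus>\<^bsub>N\<^esub> f y"
  and linear_map_smult: "\<lbrakk>linear_map K M N f; c \<in> carrier K; x \<in> carrier M\<rbrakk> \<Longrightarrow>
    f (c \<odot>\<^bsub>M\<^esub> x) = c \<odot>\<^bsub>N\<^esub> f x"
  by (auto simp: linear_map_def)

lemma linear_map_compose:
  assumes "linear_map K M N f" "linear_map K N P g"
  shows "linear_map K M P (\<lambda>x. g (f x))"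
  using assms by (auto simp: linear_map_def Pi_iff)

lemma linear_map_zero:
  assumes "linear_map K M N f" "abelian_group M" "abelian_group N"
  shows "f \<zero>\<^bsub>M\<^esub> = \<zero>\<^bsub>N\<^esub>"
proof -
  interpret M: abelian_group M by fact
  interpret N: abelian_group N by fact
  have "f \<zero>\<^bsub>M\<^esub> \<in> carrier N" "f \<zero>\<^bsub>M\<^esub> = f \<zero>\<^bsub>M\<^esub> \<oplus>\<^bsub>N\<^esub> f \<zero>\<^bsub>M\<^esub>"
    using linear_map_closed[OF assms(1), of "\<zero>\<^bsub>M\<^esub>"]
      linear_map_add[OF assms(1), of "\<zero>\<^bsub>M\<^esub>" "\<zero>\<^bsub>M\<^esub>"] by auto
  then show ?thesis by (metis N.add.l_cancel_one)
qed

lemma linear_map_finsum: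
  assumes f: "linear_map K M N f" and M: "abelian_group M" and N: "abelian_group N"
    and "finite S" "g \<in> S \<rightarrow> carrier M"
  shows "f (\<Oplus>\<^bsub>M\<^esub>s\<in>S. g s) = (\<Oplus>\<^bsub>N\<^esub>s\<in>S. f (g s))"
  using assms(4,5)
proof (induction S rule: finite_induct)
  interpret M: abelian_group M by fact
  interpret N: abelian_group N by fact
  case empty
  then show ?case by (simp add: linear_map_zero[OF f M N])
next
  interpret M: abelian_group M by fact
  interpret N: abelian_group N by fact
  case (insert s S)
  then have g: "g \<in> S \<rightarrow> carrier M" "g s \<in> carrier M" by auto
  then have "(\<lambda>s. f (g s)) \<in> S \<rightarrow> carrier N" "f (g s) \<in> carrier N"
    using linear_map_closed[OF f] by auto
  then show ?case
    using insert g by (simp add: linear_map_add[OF f] M.finsum_closed)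
qed

text \<open>A spanning set is pulled back along the inverse of \<open>f\<close>, and the
  coefficients are kept. This carries finite dimension from the space \<open>F\<^sub>0 V\<close>
  back to End(1_\<alpha>).\<close>

lemma finite_dimensional_linear_bij:
  assumes M: "module K M" and N: "module K N" and f: "linear_map K M N f"
    and bij: "bij_betw f (carrier M) (carrier N)" and fin: "finite_dimensional K N"
  shows "finite_dimensional K M"
proof -
  interpret M: module K M by fact
  interpret N: module K N by fact
  from fin obtain S where S: "finite S" "S \<subseteq> carrier N"
    and span: "\<And>x. x \<in> carrier N \<Longrightarrow> \<exists>c\<in>S \<rightarrow> carrier K. x = (\<Oplus>\<^bsub>N\<^esub>s\<in>S. c s \<odot>\<^bsub>N\<^esub> s)"
    unfolding finite_dimensional_def by blast
  define T where "T = the_inv_into (carrier M) f ` S"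
  have inj: "inj_on f (carrier M)" and im: "f ` carrier M = carrier N"
    using bij by (auto simp: bij_betw_def)
  have T: "finite T" "T \<subseteq> carrier M"
    using S the_inv_into_into[OF inj, of _ "carrier M"] im by (auto simp: T_def)
  have S_eq: "S = f ` T"
  proof -
    have "f (the_inv_into (carrier M) f s) = s" if "s \<in> S" for s
      using f_the_inv_into_f[OF inj] im S that by blast
    then show ?thesis by (simp add: T_def image_image)
  qed
  have inj_T: "inj_on f T" using inj T by (meson inj_on_subset)
  show ?thesis
    unfolding finite_dimensional_def
  proof (intro exI[of _ T] conjI ballI)
    fix x assume x: "x \<in> carrier M"
    then obtain c where c: "c \<in> S \<rightarrow> carrier K" "f x = (\<Oplus>\<^bsub>N\<^esub>s\<in>S. c s \<odot>\<^bsub>N\<^esub> s)"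
      using span linear_map_closed[OF f] by blast
    have cT: "(\<lambda>t. c (f t)) \<in> T \<rightarrow> carrier K" using c S_eq by auto
    then have sum: "(\<lambda>t. c (f t) \<odot>\<^bsub>M\<^esub> t) \<in> T \<rightarrow> carrier M" using T by auto
    have "f (\<Oplus>\<^bsub>M\<^esub>t\<in>T. c (f t) \<odot>\<^bsub>M\<^esub> t) = (\<Oplus>\<^bsub>N\<^esub>t\<in>T. f (c (f t) \<odot>\<^bsub>M\<^esub> t))"
      by (rule linear_map_finsum[OF f M.abelian_group_axioms N.abelian_group_axioms T(1) sum])
    also have "\<dots> = (\<Oplus>\<^bsub>N\<^esub>t\<in>T. c (f t) \<odot>\<^bsub>N\<^esub> f t)"
      using T cT linear_map_closed[OF f]
      by (intro N.finsum_cong') (auto simp: linear_map_smult[OF f] subset_iff Pi_iff)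
    also have "\<dots> = (\<Oplus>\<^bsub>N\<^esub>s\<in>S. c s \<odot>\<^bsub>N\<^esub> s)"
      unfolding S_eq using c S S_eq inj_T
      by (intro N.finsum_reindex[symmetric]) auto
    finally have "f (\<Oplus>\<^bsub>M\<^esub>t\<in>T. c (f t) \<odot>\<^bsub>M\<^esub> t) = f x" using c by simp
    then have "x = (\<Oplus>\<^bsub>M\<^esub>t\<in>T. c (f t) \<odot>\<^bsub>M\<^esub> t)"
      using inj_onD[OF inj, of x] x M.finsum_closed[OF sum] by simp
    then show "\<exists>c\<in>T \<rightarrow> carrier K. x = (\<Oplus>\<^bsub>M\<^esub>t\<in>T. c t \<odot>\<^bsub>M\<^esub> t)"
      using cT by (intro bexI[of _ "\<lambda>t. c (f t)"])
  qed (use T in auto)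
qed

section \<open>Morphisms out of the unit object\<close>

lemma module_sequences:
  assumes "field K"
  shows "module K (sequences K)"
proof -
  interpret field K by fact
  show ?thesis
  proof (rule moduleI)
    show "abelian_group (sequences K)"
    proof (rule abelian_groupI)
      fix x assume "x \<in> carrier (sequences K)"
      then show "\<exists>y\<in>carrier (sequences K). y \<oplus>\<^bsub>sequences K\<^esub> x = \<zero>\<^bsub>sequences K\<^esub>"
        by (intro bexI[of _ "\<lambda>n. \<ominus>\<^bsub>K\<^esub> x n"]) (auto simp: sequences_def Pi_iff l_neg)
    qed (auto simp: sequences_def Pi_iff a_ac)
  qed (auto simp: sequences_def Pi_iff l_distr r_distr m_assoc is_cring)
qed

lemma module_MObj_Vect:
  assumes "field K" "V \<in> MObj (Vect K)"
  shows "module K (subspace_of_sequences K V)"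
  unfolding subspace_of_sequences_def
  using submodule.submodule_is_module[OF _ module_sequences[OF assms(1)]] assms(2)
  by (simp add: Vect_def)

lemma mem_Vect_Hom:
  "h \<in> carrier (Vect_Hom K V W) \<longleftrightarrow> (\<exists>f. h = (V, W, f) \<and> f \<in> extensional V \<and>
     linear_map K (subspace_of_sequences K V) (subspace_of_sequences K W) f)"
  by (auto simp: Vect_Hom_def)

lemma carrier_subspace [simp]: "carrier (subspace_of_sequences K V) = V"
  by (simp add: subspace_of_sequences_def)

lemma Vect_Hom_eqI:
  assumes "h \<in> carrier (Vect_Hom K V W)" "h' \<in> carrier (Vect_Hom K V W)"
    and "\<And>x. x \<in> V \<Longrightarrow> snd (snd h) x = snd (snd h') x"
  shows "h = h'"
  using assms by (auto simp: mem_Vect_Hom intro: extensionalityI)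

lemma Vect_Hom_linear:
  assumes "h \<in> carrier (Vect_Hom K V W)"
  shows "linear_map K (subspace_of_sequences K V) (subspace_of_sequences K W) (snd (snd h))"
  using assms by (auto simp: mem_Vect_Hom)

lemma Vect_comp_apply:
  assumes "h \<in> carrier (Vect_Hom K V W)" "h' \<in> carrier (Vect_Hom K W Z)" "x \<in> V"
  shows "snd (snd (Vect_comp h' h)) x = snd (snd h') (snd (snd h) x)"
  using assms by (auto simp: mem_Vect_Hom compose_def)

text \<open>An object isomorphic to the unit object is a line: \<open>p\<close> is a basis vector of
  it and \<open>l\<close> the coordinate with respect to \<open>p\<close>.\<close>

lemma iso_from_unit_Vect:
  assumes K: "field K" and iso: "M_iso (Vect K) (Munit (Vect K)) V \<epsilon>"
  shows "\<exists>p l. p \<in> V \<and>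
    (\<forall>x\<in>V. l x \<in> carrier K \<and> l x \<odot>\<^bsub>sequences K\<^esub> p = x) \<and>
    (\<forall>c\<in>carrier K. l (c \<odot>\<^bsub>sequences K\<^esub> p) = c) \<and>
    (\<forall>x\<in>V. \<forall>y\<in>V. l (x \<oplus>\<^bsub>sequences K\<^esub> y) = l x \<oplus>\<^bsub>K\<^esub> l y) \<and>
    (\<forall>c\<in>carrier K. \<forall>x\<in>V. l (c \<odot>\<^bsub>sequences K\<^esub> x) = c \<otimes>\<^bsub>K\<^esub> l x)"
proof -
  interpret K: field K by fact
  let ?U = "Munit (Vect K)" and ?S = "subspace_of_sequences K"
  have U: "?U = {v \<in> UNIV \<rightarrow> carrier K. \<forall>n>0. v n = \<zero>\<^bsub>K\<^esub>}" by (simp add: Vect_def)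
  from iso obtain f g where f: "linear_map K (?S ?U) (?S V) f" and g: "linear_map K (?S V) (?S ?U) g"
    and gf: "(\<lambda>x\<in>?U. g (f x)) = (\<lambda>x\<in>?U. x)" and fg: "(\<lambda>x\<in>V. f (g x)) = (\<lambda>x\<in>V. x)"
    by (auto simp: M_iso_def Vect_def mem_Vect_Hom compose_def)
  define e where "e = (\<lambda>n::nat. if n = 0 then \<one>\<^bsub>K\<^esub> else \<zero>\<^bsub>K\<^esub>)"
  have e: "e \<in> ?U" by (auto simp: U e_def)
  have sm: "smult (?S W) = smult (sequences K)" "add (?S W) = add (sequences K)" for W
    by (simp_all add: subspace_of_sequences_def)
  have gf': "g (f x) = x" if "x \<in> ?U" for x using fun_cong[OF gf, of x] that by simp
  have fg': "f (g x) = x" if "x \<in> V" for x using fun_cong[OF fg, of x] that by simp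
  \<comment> \<open>The unit object consists of the sequences supported at 0, so the entry at 0 is
    the coordinate with respect to \<open>e\<close>. Hence the witnesses below: \<open>p\<close> is
    \<open>f e\<close>, and \<open>l\<close> reads off the entry at 0 after applying
    \<open>g\<close>.\<close>
  have coord: "u = u 0 \<odot>\<^bsub>sequences K\<^esub> e" "u 0 \<in> carrier K" if "u \<in> ?U" for u
    using that by (auto simp: U e_def sequences_def Pi_iff)
  have fe: "f e \<in> V" using linear_map_closed[OF f] e by simp
  have gV: "g x \<in> ?U" if "x \<in> V" for x using linear_map_closed[OF g] that by simp
  show ?thesis
  proof (intro exI[of _ "f e"] exI[of _ "\<lambda>x. g x 0"] conjI[of "f e \<in> V"] conjI[of "Ball _ _"] ballI)
    fix x assume x: "x \<in> V"
    have "g x 0 \<odot>\<^bsub>sequences K\<^esub> f e = f (g x 0 \<odot>\<^bsub>sequences K\<^esub> e)"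
      using linear_map_smult[OF f, of "g x 0" e] coord[OF gV[OF x]] e by (simp add: sm)
    then show "g x 0 \<in> carrier K \<and> g x 0 \<odot>\<^bsub>sequences K\<^esub> f e = x"
      using coord[OF gV[OF x]] fg'[OF x] by simp
  next
    fix c assume "c \<in> carrier K"
    then show "g (c \<odot>\<^bsub>sequences K\<^esub> f e) 0 = c"
      using linear_map_smult[OF g, of c "f e"] fe e
      by (simp add: sm gf') (simp add: sequences_def e_def)
  next
    fix x y assume "x \<in> V" "y \<in> V"
    then show "g (x \<oplus>\<^bsub>sequences K\<^esub> y) 0 = g x 0 \<oplus>\<^bsub>K\<^esub> g y 0"
      using linear_map_add[OF g, of x y] by (simp add: sm) (simp add: sequences_def)
  next
    fix c x assume "c \<in> carrier K" "x \<in> V"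
    then show "g (c \<odot>\<^bsub>sequences K\<^esub> x) 0 = c \<otimes>\<^bsub>K\<^esub> g x 0"
      using linear_map_smult[OF g, of c x] by (simp add: sm) (simp add: sequences_def)
  qed (fact fe)
qed

text \<open>\<open>E X w\<close> is the value of the linear map underlying
  \<open>F\<^sub>1 w\<close> at the basis vector \<open>p\<close> of the line
  \<open>F\<^sub>0 (Munit C)\<close>. A linear map out of a line is determined by its value at
  \<open>p\<close>, and this value is arbitrary; with full faithfulness this makes
  \<open>E X\<close> bijective. Functoriality gives the third property. The last one holds because
  \<open>E\<close> sends the identity of the unit to \<open>p\<close>.\<close>

lemma hom_from_unit_obtains_eval:
  assumes K: "field K" and equiv: "linear_monoidal_equivalence K C (Vect K) F\<^sub>0 F\<^sub>1 \<mu> \<epsilon>"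
    and unit: "Munit C \<in> MObj C" and id: "Mid C (Munit C) \<in> carrier (MHom C (Munit C) (Munit C))"
  obtains E where
    "\<And>X. X \<in> MObj C \<Longrightarrow>
      linear_map K (MHom C (Munit C) X) (subspace_of_sequences K (F\<^sub>0 X)) (E X)"
    "\<And>X. X \<in> MObj C \<Longrightarrow> bij_betw (E X) (carrier (MHom C (Munit C) X)) (F\<^sub>0 X)"
    "\<And>X Y v w. \<lbrakk>X \<in> MObj C; Y \<in> MObj C; v \<in> carrier (MHom C X Y); w \<in> carrier (MHom C (Munit C) X)\<rbrakk> \<Longrightarrow>
      E Y (Mcomp C v w) = snd (snd (F\<^sub>1 X Y v)) (E X w)"
    "bij_betw (\<lambda>c. c \<odot>\<^bsub>sequences K\<^esub> E (Munit C) (Mid C (Munit C))) (carrier K) (F\<^sub>0 (Munit C))"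
proof -
  interpret linear_monoidal_equivalence K C "Vect K" F\<^sub>0 F\<^sub>1 \<mu> \<epsilon> by fact
  let ?I = "Munit C" and ?S = "subspace_of_sequences K"
  have MHom: "MHom (Vect K) = Vect_Hom K" and Mcomp: "Mcomp (Vect K) = Vect_comp"
    by (simp_all add: Vect_def)
  have mod: "module K (?S (F\<^sub>0 X))" if "X \<in> MObj C" for X
    using module_MObj_Vect[OF K obj[OF that]] .
  obtain p l where p: "p \<in> F\<^sub>0 ?I"
    and l: "\<And>x. x \<in> F\<^sub>0 ?I \<Longrightarrow> l x \<in> carrier K \<and> l x \<odot>\<^bsub>sequences K\<^esub> p = x"
    and lp: "\<And>c. c \<in> carrier K \<Longrightarrow> l (c \<odot>\<^bsub>sequences K\<^esub> p) = c"
    and l_add: "\<And>x y. \<lbrakk>x \<in> F\<^sub>0 ?I; y \<in> F\<^sub>0 ?I\<rbrakk> \<Longrightarrow> l (x \<oplus>\<^bsub>sequences K\<^esub> y) = l x \<oplus>\<^bsub>K\<^esub> l y"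
    and l_smult: "\<And>c x. \<lbrakk>c \<in> carrier K; x \<in> F\<^sub>0 ?I\<rbrakk> \<Longrightarrow> l (c \<odot>\<^bsub>sequences K\<^esub> x) = c \<otimes>\<^bsub>K\<^esub> l x"
    using iso_from_unit_Vect[OF K unit_iso] by blast
  define E where "E X w = snd (snd (F\<^sub>1 ?I X w)) p" for X w
  have sm: "smult (?S W) = smult (sequences K)" "add (?S W) = add (sequences K)" for W
    by (simp_all add: subspace_of_sequences_def)
  have F: "F\<^sub>1 X Y w \<in> carrier (Vect_Hom K (F\<^sub>0 X) (F\<^sub>0 Y))"
    if "X \<in> MObj C" "Y \<in> MObj C" "w \<in> carrier (MHom C X Y)" for X Y w
    using linear_map_closed[OF linear[OF that(1,2)] that(3)] by (simp add: MHom)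
  have eval: "linear_map K (Vect_Hom K V W) (?S W) (\<lambda>h. snd (snd h) p)" if "p \<in> V" for V W
  proof (rule linear_mapI)
    show "snd (snd h) p \<in> carrier (?S W)" if "h \<in> carrier (Vect_Hom K V W)" for h
      using linear_map_closed[OF Vect_Hom_linear[OF that], of p] \<open>p \<in> V\<close> by simp
  qed (use that in \<open>simp_all add: sm\<close>, simp_all add: Vect_Hom_def case_prod_unfold)
  show ?thesis
  proof
    fix X assume X: "X \<in> MObj C"
    interpret X: module K "?S (F\<^sub>0 X)" using mod[OF X] .
    show "linear_map K (MHom C ?I X) (?S (F\<^sub>0 X)) (E X)"
      unfolding E_def using linear_map_compose[OF linear[OF unit X, unfolded MHom] eval[OF p]] .
    have "bij_betw (\<lambda>h. snd (snd h) p) (carrier (Vect_Hom K (F\<^sub>0 ?I) (F\<^sub>0 X))) (F\<^sub>0 X)"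
    proof (rule bij_betw_imageI)
      show "inj_on (\<lambda>h. snd (snd h) p) (carrier (Vect_Hom K (F\<^sub>0 ?I) (F\<^sub>0 X)))"
      proof (rule inj_onI)
        fix h h' assume h: "h \<in> carrier (Vect_Hom K (F\<^sub>0 ?I) (F\<^sub>0 X))"
          "h' \<in> carrier (Vect_Hom K (F\<^sub>0 ?I) (F\<^sub>0 X))" and eq: "snd (snd h) p = snd (snd h') p"
        show "h = h'"
        proof (rule Vect_Hom_eqI[OF h])
          fix x assume x: "x \<in> F\<^sub>0 ?I"
          have "snd (snd k) x = l x \<odot>\<^bsub>sequences K\<^esub> snd (snd k) p"
            if "k \<in> carrier (Vect_Hom K (F\<^sub>0 ?I) (F\<^sub>0 X))" for k
            using linear_map_smult[OF Vect_Hom_linear[OF that], of "l x" p] l[OF x] p by (simp add: sm)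
          then show "snd (snd h) x = snd (snd h') x" using h eq by simp
        qed
      qed
      show "(\<lambda>h. snd (snd h) p) ` carrier (Vect_Hom K (F\<^sub>0 ?I) (F\<^sub>0 X)) = F\<^sub>0 X"
      proof (intro equalityI subsetI)
        fix x assume "x \<in> (\<lambda>h. snd (snd h) p) ` carrier (Vect_Hom K (F\<^sub>0 ?I) (F\<^sub>0 X))"
        then show "x \<in> F\<^sub>0 X" using p linear_map_closed[OF Vect_Hom_linear] by fastforce
      next
        fix x assume x: "x \<in> F\<^sub>0 X"
        interpret I: module K "?S (F\<^sub>0 ?I)" using mod[OF unit] .
        \<comment> \<open>The linear map on the line that takes \<open>p\<close> to the prescribed
          vector \<open>x\<close>.\<close>
        define h where "h = (\<lambda>y\<in>F\<^sub>0 ?I. l y \<odot>\<^bsub>sequences K\<^esub> x)"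
        have clos: "y \<oplus>\<^bsub>sequences K\<^esub> z \<in> F\<^sub>0 ?I" "c \<odot>\<^bsub>sequences K\<^esub> y \<in> F\<^sub>0 ?I"
          if "y \<in> F\<^sub>0 ?I" "z \<in> F\<^sub>0 ?I" "c \<in> carrier K" for y z c
          using I.M.a_closed[of y z] I.smult_closed[of c y] that by (auto simp: sm)
        have "linear_map K (?S (F\<^sub>0 ?I)) (?S (F\<^sub>0 X)) h"
          using x l clos X.smult_closed[of _ x] X.smult_l_distr[of _ _ x] X.smult_assoc1[of _ _ x]
          by (intro linear_mapI) (auto simp: h_def sm l_add l_smult)
        then have "(F\<^sub>0 ?I, F\<^sub>0 X, h) \<in> carrier (Vect_Hom K (F\<^sub>0 ?I) (F\<^sub>0 X))"
          by (auto simp: mem_Vect_Hom h_def)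
        moreover have "h p = x"
          using lp[of "\<one>\<^bsub>K\<^esub>"] p x I.smult_one[of p] X.smult_one[of x] by (simp add: h_def sm)
        ultimately show "x \<in> (\<lambda>h. snd (snd h) p) ` carrier (Vect_Hom K (F\<^sub>0 ?I) (F\<^sub>0 X))"
          by force
      qed
    qed
    from bij_betw_trans[OF fully_faithful[OF unit X, unfolded MHom] this]
    show "bij_betw (E X) (carrier (MHom C ?I X)) (F\<^sub>0 X)"
      by (rule bij_betw_cong[THEN iffD1, rotated]) (simp add: E_def)
  next
    fix X Y v w assume *: "X \<in> MObj C" "Y \<in> MObj C" "v \<in> carrier (MHom C X Y)"
      "w \<in> carrier (MHom C ?I X)"
    then show "E Y (Mcomp C v w) = snd (snd (F\<^sub>1 X Y v)) (E X w)"
      using Vect_comp_apply[OF F[OF unit *(1,4)] F[OF *(1,2,3)] p] comp[OF unit *(1,2,4,3)]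
      by (simp add: E_def Mcomp)
  next
    interpret I: module K "?S (F\<^sub>0 ?I)" using mod[OF unit] .
    have "E ?I (Mid C ?I) = p" using p ident[OF unit] by (simp add: E_def Vect_def)
    moreover have "bij_betw (\<lambda>c. c \<odot>\<^bsub>sequences K\<^esub> p) (carrier K) (F\<^sub>0 ?I)"
      using p l lp I.smult_closed[of _ p]
      by (intro bij_betw_byWitness[where f' = l]) (auto simp: sm)
    ultimately show "bij_betw (\<lambda>c. c \<odot>\<^bsub>sequences K\<^esub> E ?I (Mid C ?I)) (carrier K) (F\<^sub>0 ?I)" by simp
  qed
qed

section \<open>Calculus of 2-morphisms\<close>

context linear_2category
begin

text \<open>2-morphisms carry no source or target, and the hom-sets are not assumed disjoint, so
  every locale axiom has a long list of typing premises. Bundling them leaves one premise per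
  2-morphism, and typing facts compose along \<open>cell_vcomp\<close> and
  \<open>cell_hcomp\<close>.\<close>

definition cell :: "'o \<Rightarrow> 'o \<Rightarrow> 'm \<Rightarrow> 'm \<Rightarrow> 'c \<Rightarrow> bool"
  where "cell \<alpha> \<beta> X Y \<Phi> \<longleftrightarrow>
    \<alpha> \<in> Obj B \<and> \<beta> \<in> Obj B \<and> X \<in> \<B> \<alpha> \<beta> \<and> Y \<in> \<B> \<alpha> \<beta> \<and> \<Phi> \<in> carrier (\<H> X Y)"

lemma cellI: "\<lbrakk>\<alpha> \<in> Obj B; \<beta> \<in> Obj B; X \<in> \<B> \<alpha> \<beta>; Y \<in> \<B> \<alpha> \<beta>; \<Phi> \<in> carrier (\<H> X Y)\<rbrakk> \<Longrightarrow>
    cell \<alpha> \<beta> X Y \<Phi>"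
  by (simp add: cell_def)

lemma cell_id: "\<lbrakk>\<alpha> \<in> Obj B; \<beta> \<in> Obj B; X \<in> \<B> \<alpha> \<beta>\<rbrakk> \<Longrightarrow> cell \<alpha> \<beta> X X (\<iota> X)"
  by (simp add: cell_def id2_hom)

lemma cell_vcomp:
  assumes "cell \<alpha> \<beta> X Y \<Phi>" "cell \<alpha> \<beta> Y Z \<Psi>"
  shows "cell \<alpha> \<beta> X Z (\<Psi> \<cdot> \<Phi>)"
  using assms vcomp_linear_left[of \<alpha> \<beta> X Y Z \<Phi>] by (auto simp: cell_def linear_map_def)

lemma cell_hcomp:
  assumes "cell \<alpha> \<beta> X X' \<Phi>" "cell \<beta> \<gamma> Y Y' \<Psi>"
  shows "cell \<alpha> \<gamma> (Y \<star> X) (Y' \<star> X') (\<Psi> \<bullet> \<Phi>)"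
  using assms hcomp2_linear_left[of \<alpha> \<beta> \<gamma> X X' Y Y' \<Phi>] hcomp1_mor
  by (auto simp: cell_def linear_map_def)

lemma vcomp_assoc': "\<lbrakk>cell \<alpha> \<beta> X Y \<Phi>; cell \<alpha> \<beta> Y Z \<Psi>; cell \<alpha> \<beta> Z W \<Theta>\<rbrakk> \<Longrightarrow>
    (\<Theta> \<cdot> \<Psi>) \<cdot> \<Phi> = \<Theta> \<cdot> (\<Psi> \<cdot> \<Phi>)"
  unfolding cell_def by (blast intro: vcomp_assoc)

lemma vcomp_id_left: "cell \<alpha> \<beta> X Y \<Phi> \<Longrightarrow> \<iota> Y \<cdot> \<Phi> = \<Phi>"
  and vcomp_id_right: "cell \<alpha> \<beta> X Y \<Phi> \<Longrightarrow> \<Phi> \<cdot> \<iota> X = \<Phi>"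
  unfolding cell_def by (blast intro: vcomp_unit_left vcomp_unit_right)+

lemma hcomp_assoc': "\<lbrakk>cell \<alpha> \<beta> X X' \<Phi>; cell \<beta> \<gamma> Y Y' \<Psi>; cell \<gamma> \<delta> Z Z' \<Theta>\<rbrakk> \<Longrightarrow>
    (\<Theta> \<bullet> \<Psi>) \<bullet> \<Phi> = \<Theta> \<bullet> (\<Psi> \<bullet> \<Phi>)"
  unfolding cell_def by (blast intro: hcomp2_assoc)

lemma hcomp_id_left: "cell \<alpha> \<beta> X Y \<Phi> \<Longrightarrow> \<iota> (\<I> \<beta>) \<bullet> \<Phi> = \<Phi>"
  and hcomp_id_right: "cell \<alpha> \<beta> X Y \<Phi> \<Longrightarrow> \<Phi> \<bullet> \<iota> (\<I> \<alpha>) = \<Phi>"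
  unfolding cell_def by (blast intro: hcomp2_unit_left hcomp2_unit_right)+

lemma interchange_law:
  "\<lbrakk>cell \<alpha> \<beta> X X' \<Phi>; cell \<alpha> \<beta> X' X'' \<Phi>'; cell \<beta> \<gamma> Y Y' \<Psi>; cell \<beta> \<gamma> Y' Y'' \<Psi>'\<rbrakk> \<Longrightarrow>
    (\<Psi>' \<bullet> \<Phi>') \<cdot> (\<Psi> \<bullet> \<Phi>) = (\<Psi>' \<cdot> \<Psi>) \<bullet> (\<Phi>' \<cdot> \<Phi>)"
  unfolding cell_def by (rule middle_four[symmetric]; blast)

lemma id_hcomp: "\<lbrakk>\<alpha> \<in> Obj B; \<beta> \<in> Obj B; \<gamma> \<in> Obj B; X \<in> \<B> \<alpha> \<beta>; Y \<in> \<B> \<beta> \<gamma>\<rbrakk> \<Longrightarrow>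
    \<iota> (Y \<star> X) = \<iota> Y \<bullet> \<iota> X"
  by (simp add: hcomp2_id2)

lemma cell_idE:
  assumes "cell \<alpha> \<beta> X Y \<Phi>"
  shows "cell \<alpha> \<beta> X X (\<iota> X)" "cell \<alpha> \<beta> Y Y (\<iota> Y)"
  using assms by (auto simp: cell_def id2_hom)

text \<open>Together with \<open>hcomp_right_left\<close> this is the slide move of string diagrams:
  2-morphisms on adjacent strands pass each other, since both orders equal the horizontal composite.
  Most steps below that move one 2-morphism past another use this pair.\<close>

lemma hcomp_left_right:
  assumes "cell \<alpha> \<beta> X X' \<Phi>" "cell \<beta> \<gamma> Y Y' \<Psi>"
  shows "(\<Psi> \<bullet> \<iota> X') \<cdot> (\<iota> Y \<bullet> \<Phi>) = \<Psi> \<bullet> \<Phi>"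
  using interchange_law[OF assms(1) cell_idE(2)[OF assms(1)] cell_idE(1)[OF assms(2)] assms(2)]
    assms by (simp add: vcomp_id_left vcomp_id_right)

lemma hcomp_right_left:
  assumes "cell \<alpha> \<beta> X X' \<Phi>" "cell \<beta> \<gamma> Y Y' \<Psi>"
  shows "(\<iota> Y' \<bullet> \<Phi>) \<cdot> (\<Psi> \<bullet> \<iota> X) = \<Psi> \<bullet> \<Phi>"
  using interchange_law[OF cell_idE(1)[OF assms(1)] assms(1,2) cell_idE(2)[OF assms(2)]]
    assms by (simp add: vcomp_id_left vcomp_id_right)

lemma whisker_left_vcomp:
  assumes "cell \<alpha> \<beta> X X' \<Phi>" "cell \<alpha> \<beta> X' X'' \<Phi>'" "cell \<beta> \<gamma> Y Y (\<iota> Y)"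
  shows "\<iota> Y \<bullet> (\<Phi>' \<cdot> \<Phi>) = (\<iota> Y \<bullet> \<Phi>') \<cdot> (\<iota> Y \<bullet> \<Phi>)"
  using interchange_law[OF assms(1,2,3,3)] vcomp_id_left[OF assms(3)] by simp

lemma whisker_right_vcomp:
  assumes "cell \<beta> \<gamma> Y Y' \<Psi>" "cell \<beta> \<gamma> Y' Y'' \<Psi>'" "cell \<alpha> \<beta> X X (\<iota> X)"
  shows "(\<Psi>' \<cdot> \<Psi>) \<bullet> \<iota> X = (\<Psi>' \<bullet> \<iota> X) \<cdot> (\<Psi> \<bullet> \<iota> X)"
  using interchange_law[OF assms(3,3,1,2)] vcomp_id_left[OF assms(3)] by simp

lemma End_id_commute:
  assumes "\<alpha> \<in> Obj B" "\<phi> \<in> carrier (\<H> (\<I> \<alpha>) (\<I> \<alpha>))" "\<psi> \<in> carrier (\<H> (\<I> \<alpha>) (\<I> \<alpha>))"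
  shows "\<phi> \<cdot> \<psi> = \<psi> \<cdot> \<phi>"
proof -
  have c: "cell \<alpha> \<alpha> (\<I> \<alpha>) (\<I> \<alpha>) \<phi>" "cell \<alpha> \<alpha> (\<I> \<alpha>) (\<I> \<alpha>) \<psi>"
    using assms id1_mor by (auto intro: cellI)
  \<comment> \<open>Both products equal \<open>\<phi> \<bullet> \<psi>\<close>, because the identity
    on \<open>\<I> \<alpha>\<close> is a two-sided unit for \<open>\<bullet>\<close>.\<close>
  show ?thesis
    using hcomp_left_right[OF c(2,1)] hcomp_right_left[OF c(2,1)]
      hcomp_id_left[OF c(1)] hcomp_id_left[OF c(2)] hcomp_id_right[OF c(1)] hcomp_id_right[OF c(2)]
    by simp
qed

end

section \<open>Transposes along the two adjunctions between a 1-morphism and its dagger\<close>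

context linear_pivotal_2category
begin

lemma cell_pivotal:
  assumes "\<alpha> \<in> Obj B" "\<beta> \<in> Obj B" "X \<in> \<B> \<alpha> \<beta>"
  shows "cell \<beta> \<alpha> (X\<dagger>) (X\<dagger>) (\<iota> (X\<dagger>))"
    "cell \<alpha> \<alpha> (X\<dagger> \<star> X) (\<I> \<alpha>) (ev B X)" "cell \<beta> \<beta> (\<I> \<beta>) (X \<star> X\<dagger>) (coev B X)"
    "cell \<beta> \<beta> (X \<star> X\<dagger>) (\<I> \<beta>) (ev_tilde B X)" "cell \<alpha> \<alpha> (\<I> \<alpha>) (X\<dagger> \<star> X) (coev_tilde B X)"
  using assms dagger_mor[OF assms] hcomp1_mor[OF assms(1,2,1,3)] hcomp1_mor[OF assms(2,1,2) _ assms(3)]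
  by (simp_all add: cell_def id1_mor id2_hom ev_hom coev_hom ev_tilde_hom coev_tilde_hom)

text \<open>Bending X back with \<open>coev\<close> recovers \<open>g\<close>: it slides past
  \<open>coev\<close>, and what remains is the zigzag of the left adjunction. Only this half of the
  bijection with Hom(X\<dagger> \<otimes> X, 1) is established, since on that side injectivity
  suffices.\<close>

lemma ev_hcomp_inverse:
  assumes X: "\<alpha> \<in> Obj B" "\<beta> \<in> Obj B" "X \<in> \<B> \<alpha> \<beta>" and g: "cell \<beta> \<alpha> (X\<dagger>) (X\<dagger>) g"
  shows "((ev B X \<cdot> (g \<bullet> \<iota> X)) \<bullet> \<iota> (X\<dagger>)) \<cdot> (\<iota> (X\<dagger>) \<bullet> coev B X) = g"
proof -
  note p = cell_pivotal[OF X] and i = cell_id[OF X]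
  have gi: "cell \<alpha> \<alpha> (X\<dagger> \<star> X) (X\<dagger> \<star> X) (g \<bullet> \<iota> X)" by (rule cell_hcomp[OF i g])
  have ei: "cell \<beta> \<alpha> ((X\<dagger> \<star> X) \<star> X\<dagger>) (\<I> \<alpha> \<star> X\<dagger>) (ev B X \<bullet> \<iota> (X\<dagger>))" by (rule cell_hcomp[OF p(1,2)])
  have gii: "cell \<beta> \<alpha> ((X\<dagger> \<star> X) \<star> X\<dagger>) ((X\<dagger> \<star> X) \<star> X\<dagger>) ((g \<bullet> \<iota> X) \<bullet> \<iota> (X\<dagger>))"
    by (rule cell_hcomp[OF p(1) gi])
  have eq: "(g \<bullet> \<iota> X) \<bullet> \<iota> (X\<dagger>) = g \<bullet> \<iota> (X \<star> X\<dagger>)"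
    using hcomp_assoc'[OF p(1) i g] id_hcomp[OF X(2,1,2) _ X(3)] dagger_mor[OF X] by simp
  have ass: "(X\<dagger> \<star> X) \<star> X\<dagger> = X\<dagger> \<star> (X \<star> X\<dagger>)" "X\<dagger> \<star> \<I> \<beta> = X\<dagger>" "\<I> \<alpha> \<star> X\<dagger> = X\<dagger>"
    using X dagger_mor[OF X] hcomp1_assoc[OF X(2,1,2,1)] hcomp1_unit_right[OF X(2,1)]
      hcomp1_unit_left[OF X(2,1)] by simp_all
  have ci: "cell \<beta> \<alpha> (X\<dagger>) ((X\<dagger> \<star> X) \<star> X\<dagger>) (\<iota> (X\<dagger>) \<bullet> coev B X)"
    using cell_hcomp[OF p(3,1)] by (simp add: ass)
  have "((ev B X \<cdot> (g \<bullet> \<iota> X)) \<bullet> \<iota> (X\<dagger>)) \<cdot> (\<iota> (X\<dagger>) \<bullet> coev B X) =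
      (ev B X \<bullet> \<iota> (X\<dagger>)) \<cdot> ((g \<bullet> \<iota> (X \<star> X\<dagger>)) \<cdot> (\<iota> (X\<dagger>) \<bullet> coev B X))"
    using whisker_right_vcomp[OF gi p(2,1)] vcomp_assoc'[OF ci gii ei] by (simp add: eq)
  \<comment> \<open>Both sides are \<open>g \<bullet> coev B X\<close>.\<close>
  also have "(g \<bullet> \<iota> (X \<star> X\<dagger>)) \<cdot> (\<iota> (X\<dagger>) \<bullet> coev B X) = (\<iota> (X\<dagger>) \<bullet> coev B X) \<cdot> g"
    using hcomp_left_right[OF p(3) g] hcomp_right_left[OF p(3) g] hcomp_id_right[OF g] by simp
  also have "(ev B X \<bullet> \<iota> (X\<dagger>)) \<cdot> ((\<iota> (X\<dagger>) \<bullet> coev B X) \<cdot> g) = g"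
    using vcomp_assoc'[OF g ci ei] zigzag_left'[OF X] vcomp_id_left[OF g] by simp
  finally show ?thesis .
qed

text \<open>The mirror image for the right adjunction: \<open>g\<close> slides past
  \<open>ev_tilde\<close>, leaving \<open>zigzag_right'\<close>.\<close>

lemma coev_tilde_hcomp_inverse:
  assumes X: "\<alpha> \<in> Obj B" "\<beta> \<in> Obj B" "X \<in> \<B> \<alpha> \<beta>" and g: "cell \<beta> \<alpha> (X\<dagger>) (X\<dagger>) g"
  shows "(\<iota> (X\<dagger>) \<bullet> ev_tilde B X) \<cdot> (((g \<bullet> \<iota> X) \<cdot> coev_tilde B X) \<bullet> \<iota> (X\<dagger>)) = g"
proof -
  note p = cell_pivotal[OF X] and i = cell_id[OF X]
  have gi: "cell \<alpha> \<alpha> (X\<dagger> \<star> X) (X\<dagger> \<star> X) (g \<bullet> \<iota> X)" by (rule cell_hcomp[OF i g])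
  have gii: "cell \<beta> \<alpha> ((X\<dagger> \<star> X) \<star> X\<dagger>) ((X\<dagger> \<star> X) \<star> X\<dagger>) ((g \<bullet> \<iota> X) \<bullet> \<iota> (X\<dagger>))"
    by (rule cell_hcomp[OF p(1) gi])
  have eq: "(g \<bullet> \<iota> X) \<bullet> \<iota> (X\<dagger>) = g \<bullet> \<iota> (X \<star> X\<dagger>)"
    using hcomp_assoc'[OF p(1) i g] id_hcomp[OF X(2,1,2) _ X(3)] dagger_mor[OF X] by simp
  have ass: "(X\<dagger> \<star> X) \<star> X\<dagger> = X\<dagger> \<star> (X \<star> X\<dagger>)" "X\<dagger> \<star> \<I> \<beta> = X\<dagger>" "\<I> \<alpha> \<star> X\<dagger> = X\<dagger>"
    using X dagger_mor[OF X] hcomp1_assoc[OF X(2,1,2,1)] hcomp1_unit_right[OF X(2,1)]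
      hcomp1_unit_left[OF X(2,1)] by simp_all
  have ci: "cell \<beta> \<alpha> (X\<dagger>) ((X\<dagger> \<star> X) \<star> X\<dagger>) (coev_tilde B X \<bullet> \<iota> (X\<dagger>))"
    using cell_hcomp[OF p(1,5)] by (simp add: ass)
  have ei: "cell \<beta> \<alpha> ((X\<dagger> \<star> X) \<star> X\<dagger>) (X\<dagger>) (\<iota> (X\<dagger>) \<bullet> ev_tilde B X)"
    using cell_hcomp[OF p(4,1)] by (simp add: ass)
  have "(\<iota> (X\<dagger>) \<bullet> ev_tilde B X) \<cdot> (((g \<bullet> \<iota> X) \<cdot> coev_tilde B X) \<bullet> \<iota> (X\<dagger>)) =
      ((\<iota> (X\<dagger>) \<bullet> ev_tilde B X) \<cdot> (g \<bullet> \<iota> (X \<star> X\<dagger>))) \<cdot> (coev_tilde B X \<bullet> \<iota> (X\<dagger>))"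
    using whisker_right_vcomp[OF p(5) gi p(1)] vcomp_assoc'[OF ci gii ei] by (simp add: eq)
  also have "(\<iota> (X\<dagger>) \<bullet> ev_tilde B X) \<cdot> (g \<bullet> \<iota> (X \<star> X\<dagger>)) = g \<cdot> (\<iota> (X\<dagger>) \<bullet> ev_tilde B X)"
    using hcomp_left_right[OF p(4) g] hcomp_right_left[OF p(4) g] hcomp_id_right[OF g] by simp
  also have "(g \<cdot> (\<iota> (X\<dagger>) \<bullet> ev_tilde B X)) \<cdot> (coev_tilde B X \<bullet> \<iota> (X\<dagger>)) = g"
    using vcomp_assoc'[OF ci ei g] zigzag_right'[OF X] vcomp_id_right[OF g] by simp
  finally show ?thesis .
qed

text \<open>The opposite composite, which gives surjectivity of the transpose onto Hom(1, X\<dagger>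
  \<otimes> X). Here \<open>w\<close> slides past \<open>coev_tilde\<close>, and the remaining piece
  is the other zigzag, \<open>zigzag_right\<close>, whiskered by X\<dagger>.\<close>

lemma coev_tilde_hcomp_inverse':
  assumes X: "\<alpha> \<in> Obj B" "\<beta> \<in> Obj B" "X \<in> \<B> \<alpha> \<beta>" and w: "cell \<alpha> \<alpha> (\<I> \<alpha>) (X\<dagger> \<star> X) w"
  shows "(((\<iota> (X\<dagger>) \<bullet> ev_tilde B X) \<cdot> (w \<bullet> \<iota> (X\<dagger>))) \<bullet> \<iota> X) \<cdot> coev_tilde B X = w"
proof -
  let ?V = "X\<dagger> \<star> X"
  note p = cell_pivotal[OF X] and i = cell_id[OF X]
  note D = dagger_mor[OF X]
  have ass: "(X\<dagger> \<star> X) \<star> X\<dagger> = X\<dagger> \<star> (X \<star> X\<dagger>)" "X\<dagger> \<star> \<I> \<beta> = X\<dagger>" "\<I> \<alpha> \<star> X\<dagger> = X\<dagger>" "\<I> \<beta> \<star> X = X"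
    "X \<star> \<I> \<alpha> = X" "(X\<dagger> \<star> (X \<star> X\<dagger>)) \<star> X = ?V \<star> ?V" "X\<dagger> \<star> ((X \<star> X\<dagger>) \<star> X) = ?V \<star> ?V"
    using X D hcomp1_assoc[OF X(2,1,2,1)] hcomp1_unit_right[OF X(2,1)]
      hcomp1_unit_left[OF X(2,1)] hcomp1_unit_left[OF X] hcomp1_unit_right[OF X]
      hcomp1_assoc[OF X(1,2,1,2)] hcomp1_assoc[OF X(1,1,2,1)]
      hcomp1_assoc[OF X(1,2) X(2,1)] hcomp1_mor[OF X(1,2,1,3)] hcomp1_mor[OF X(2,1,2) _ X(3)]
    by simp_all
  have VI: "cell \<alpha> \<alpha> ?V ?V (\<iota> ?V)" "\<iota> ?V = \<iota> (X\<dagger>) \<bullet> \<iota> X"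
    using cell_idE(2)[OF w] id_hcomp[OF X(1,2,1,3) D] by simp_all
  have wi: "cell \<beta> \<alpha> (X\<dagger>) (?V \<star> X\<dagger>) (w \<bullet> \<iota> (X\<dagger>))"
    using cell_hcomp[OF p(1) w] by (simp add: ass)
  have ei: "cell \<beta> \<alpha> (?V \<star> X\<dagger>) (X\<dagger>) (\<iota> (X\<dagger>) \<bullet> ev_tilde B X)"
    using cell_hcomp[OF p(4,1)] by (simp add: ass)
  have eX: "cell \<alpha> \<beta> ((X \<star> X\<dagger>) \<star> X) X (ev_tilde B X \<bullet> \<iota> X)"
    using cell_hcomp[OF i p(4)] by (simp add: ass)
  have Xc: "cell \<alpha> \<beta> X ((X \<star> X\<dagger>) \<star> X) (\<iota> X \<bullet> coev_tilde B X)"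
    using cell_hcomp[OF p(5) i] hcomp1_assoc[OF X(1,2,1,2) X(3) D X(3)] by (simp add: ass)
  have eii: "cell \<alpha> \<alpha> (?V \<star> ?V) ?V (\<iota> (X\<dagger>) \<bullet> (ev_tilde B X \<bullet> \<iota> X))"
    using cell_hcomp[OF eX p(1)] by (simp add: ass)
  have wV: "cell \<alpha> \<alpha> ?V (?V \<star> ?V) (w \<bullet> \<iota> ?V)"
    using cell_hcomp[OF VI(1) w] hcomp1_unit_left[OF X(1,1) hcomp1_mor[OF X(1,2,1,3) D]] by simp
  have Vc: "cell \<alpha> \<alpha> ?V (?V \<star> ?V) (\<iota> ?V \<bullet> coev_tilde B X)"
    using cell_hcomp[OF p(5) VI(1)] hcomp1_unit_right[OF X(1,1) hcomp1_mor[OF X(1,2,1,3) D]] by simp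
  have "(((\<iota> (X\<dagger>) \<bullet> ev_tilde B X) \<cdot> (w \<bullet> \<iota> (X\<dagger>))) \<bullet> \<iota> X) \<cdot> coev_tilde B X =
      ((\<iota> (X\<dagger>) \<bullet> (ev_tilde B X \<bullet> \<iota> X)) \<cdot> (w \<bullet> \<iota> ?V)) \<cdot> coev_tilde B X"
    using whisker_right_vcomp[OF wi ei i] hcomp_assoc'[OF i p(1) w] hcomp_assoc'[OF i p(4,1)] VI(2)
    by simp
  also have "\<dots> = (\<iota> (X\<dagger>) \<bullet> (ev_tilde B X \<bullet> \<iota> X)) \<cdot> ((w \<bullet> \<iota> ?V) \<cdot> coev_tilde B X)"
    by (rule vcomp_assoc'[OF p(5) wV eii])
  \<comment> \<open>Both sides are \<open>w \<bullet> coev_tilde B X\<close>.\<close>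
  also have "(w \<bullet> \<iota> ?V) \<cdot> coev_tilde B X = (\<iota> ?V \<bullet> coev_tilde B X) \<cdot> w"
    using hcomp_left_right[OF p(5) w] hcomp_right_left[OF p(5) w]
    unfolding hcomp_id_right[OF w] hcomp_id_left[OF p(5)] by (rule trans[OF _ sym])
  also have "(\<iota> (X\<dagger>) \<bullet> (ev_tilde B X \<bullet> \<iota> X)) \<cdot> ((\<iota> ?V \<bullet> coev_tilde B X) \<cdot> w) =
      ((\<iota> (X\<dagger>) \<bullet> (ev_tilde B X \<bullet> \<iota> X)) \<cdot> (\<iota> ?V \<bullet> coev_tilde B X)) \<cdot> w"
    by (rule vcomp_assoc'[OF w Vc eii, symmetric])
  also have "\<iota> ?V \<bullet> coev_tilde B X = \<iota> (X\<dagger>) \<bullet> (\<iota> X \<bullet> coev_tilde B X)"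
    using hcomp_assoc'[OF p(5) i p(1)] VI(2) by simp
  also have "(\<iota> (X\<dagger>) \<bullet> (ev_tilde B X \<bullet> \<iota> X)) \<cdot> (\<iota> (X\<dagger>) \<bullet> (\<iota> X \<bullet> coev_tilde B X)) = \<iota> ?V"
    using whisker_left_vcomp[OF Xc eX p(1)] zigzag_right[OF X] VI(2) by simp
  also have "\<iota> ?V \<cdot> w = w" by (rule vcomp_id_left[OF w])
  finally show ?thesis .
qed

end

section \<open>Endomorphisms of the cofold\<close>

context monoidal_2category_with_duals
begin

lemma cell_lwhisker:
  assumes "\<gamma> \<in> Obj B" "cell \<alpha> \<beta> X Y \<Phi>"
  shows "cell (\<gamma> \<box> \<alpha>) (\<gamma> \<box> \<beta>) (\<gamma> \<triangleright> X) (\<gamma> \<triangleright> Y) (\<gamma> \<unrhd> \<Phi>)"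
  using assms lwhisker2_linear[of \<gamma> \<alpha> \<beta> X Y] lwhisker1_mor box_obj
  by (auto simp: cell_def linear_map_def)

lemma cell_rwhisker:
  assumes "\<gamma> \<in> Obj B" "cell \<alpha> \<beta> X Y \<Phi>"
  shows "cell (\<alpha> \<box> \<gamma>) (\<beta> \<box> \<gamma>) (X \<triangleleft> \<gamma>) (Y \<triangleleft> \<gamma>) (\<Phi> \<unlhd> \<gamma>)"
  using assms rwhisker2_linear[of \<gamma> \<alpha> \<beta> X Y] rwhisker1_mor box_obj
  by (auto simp: cell_def linear_map_def)

text \<open>The swallowtail identity is stated for \<open>\<eta>\<dagger>\<close>, so we work with \<open>End(\<eta>\<dagger>)\<close> rather than with the algebra
  \<open>End(\<eta>)\<close> in which \<open>tilde2\<close> takes its values; the two are exchanged by taking mates.\<close>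

definition cofold_End :: "'o \<Rightarrow> 'c \<Rightarrow> 'c"
  where "cofold_End \<alpha> \<phi> = \<iota> ((\<eta> \<alpha>)\<dagger>) \<bullet> (\<phi> \<unlhd> \<alpha>\<sharp>)"

text \<open>Besides the swallowtail identity, the computation in \<open>fold_cut\<close> uses only
  this boundary of the mate: being a 2-morphism out of an identity, its whiskering can be slid past
  any endomorphism of the cofold. The three factors fit together only after strict associativity and
  unitality of \<open>\<box>\<close> and \<open>\<star>\<close> are applied to their
  boundaries.\<close>

lemma cell_triangulator_mate:
  assumes a: "\<alpha> \<in> Obj B"
  shows "cell \<alpha> \<alpha> (\<I> \<alpha>) ((\<alpha> \<triangleright> (\<eta> (\<alpha>\<sharp>))\<dagger>) \<star> (\<eta> \<alpha> \<triangleleft> \<alpha>)) (triangulator_mate B \<alpha>)"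
proof -
  let ?b = "\<alpha>\<sharp>"
  let ?f = "\<eta> \<alpha>" and ?e = "(\<eta> ?b)\<dagger>"
  have b: "?b \<in> Obj B" and bb: "?b\<sharp> = \<alpha>" using a dual_obj dual_dual by auto
  note O = unit_obj and ab = box_obj[OF a b] and ba = box_obj[OF b a]
  have aba: "\<alpha> \<box> (?b \<box> \<alpha>) \<in> Obj B" "(\<alpha> \<box> ?b) \<box> \<alpha> = \<alpha> \<box> (?b \<box> \<alpha>)"
    "\<O> \<box> \<alpha> = \<alpha>" "\<alpha> \<box> \<O> = \<alpha>"
    using a b by (simp_all add: box_obj box_assoc box_unit_left box_unit_right)
  have f: "?f \<in> \<B> \<O> (\<alpha> \<box> ?b)" and e': "\<eta> ?b \<in> \<B> \<O> (?b \<box> \<alpha>)"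
    using fold_mor[OF a] fold_mor[OF b] bb by auto
  note pf = cell_pivotal[OF O ab f] and pe = cell_pivotal[OF O ba e']
  define U where "U = \<alpha> \<triangleright> ?e"
  define V where "V = ?f \<triangleleft> \<alpha>"
  define W where "W = ?f\<dagger> \<triangleleft> \<alpha>"
  define Z where "Z = \<alpha> \<triangleright> \<eta> ?b"
  have U: "U \<in> \<B> (\<alpha> \<box> (?b \<box> \<alpha>)) \<alpha>"
    using lwhisker1_mor[OF a ba O dagger_mor[OF O ba e']] aba by (simp add: U_def)
  have V: "V \<in> \<B> \<alpha> (\<alpha> \<box> (?b \<box> \<alpha>))"
    using rwhisker1_mor[OF a O ab f] aba by (simp add: V_def)
  have W: "W \<in> \<B> (\<alpha> \<box> (?b \<box> \<alpha>)) \<alpha>"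
    using rwhisker1_mor[OF a ab O dagger_mor[OF O ab f]] aba by (simp add: W_def)
  have Z: "Z \<in> \<B> \<alpha> (\<alpha> \<box> (?b \<box> \<alpha>))"
    using lwhisker1_mor[OF a O ba e'] aba by (simp add: Z_def)
  have UV: "U \<star> V \<in> \<B> \<alpha> \<alpha>" using hcomp1_mor[OF a aba(1) a V U] .
  have T: "cell \<alpha> \<alpha> (W \<star> Z) (\<I> \<alpha>) (\<T> \<alpha>)"
    using triangulator_iso[OF a] hcomp1_mor[OF a aba(1) a Z W] id1_mor[OF a] a
    by (simp add: iso2_def cell_def W_def Z_def)
  have C: "cell \<alpha> \<alpha> (\<I> \<alpha>) (U \<star> Z) (\<alpha> \<unrhd> coev_tilde B (\<eta> ?b))"
    using cell_lwhisker[OF a pe(5)] lwhisker1_hcomp1[OF a O ba O e' dagger_mor[OF O ba e']]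
      lwhisker1_id1[OF a O] aba by (simp add: U_def Z_def)
  have "cell (\<alpha> \<box> (?b \<box> \<alpha>)) (\<alpha> \<box> (?b \<box> \<alpha>)) (\<I> (\<alpha> \<box> (?b \<box> \<alpha>))) (V \<star> W) (coev B ?f \<unlhd> \<alpha>)"
    using cell_rwhisker[OF a pf(3)] rwhisker1_hcomp1[OF a ab O ab dagger_mor[OF O ab f] f]
      rwhisker1_id1[OF a ab] aba by (simp add: V_def W_def)
  from cell_hcomp[OF cell_hcomp[OF cell_id[OF a aba(1) Z] this] cell_id[OF aba(1) a U]]
  have D: "cell \<alpha> \<alpha> (U \<star> Z) ((U \<star> V) \<star> (W \<star> Z)) (\<iota> U \<bullet> (coev B ?f \<unlhd> \<alpha>) \<bullet> \<iota> Z)"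
    using hcomp1_unit_left[OF a aba(1) Z] hcomp1_assoc[OF a aba(1) a aba(1) Z W V]
      hcomp1_assoc[OF a a aba(1) a hcomp1_mor[OF a aba(1) a Z W] V U] by simp
  have "cell \<alpha> \<alpha> ((U \<star> V) \<star> (W \<star> Z)) (U \<star> V) (\<iota> (U \<star> V) \<bullet> \<T> \<alpha>)"
    using cell_hcomp[OF T cell_id[OF a a UV]] hcomp1_unit_right[OF a a UV] by simp
  from cell_vcomp[OF cell_vcomp[OF C D] this]
  show ?thesis by (simp add: triangulator_mate_def U_def V_def Z_def)
qed

lemma cell_cofold_End:
  assumes a: "\<alpha> \<in> Obj B" and \<phi>: "cell \<alpha> \<alpha> (\<I> \<alpha>) (\<I> \<alpha>) \<phi>"
  shows "cell (\<alpha> \<box> \<alpha>\<sharp>) \<O> ((\<eta> \<alpha>)\<dagger>) ((\<eta> \<alpha>)\<dagger>) (cofold_End \<alpha> \<phi>)"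
proof -
  note b = dual_obj[OF a] and O = unit_obj
  note ab = box_obj[OF a b]
  note e = dagger_mor[OF O ab fold_mor[OF a]]
  show ?thesis
    using cell_hcomp[OF cell_rwhisker[OF b \<phi>] cell_id[OF ab O e]] rwhisker1_id1[OF b a]
      hcomp1_unit_right[OF ab O e] by (simp add: cofold_End_def)
qed

text \<open>The inverse of \<open>cofold_End\<close>, where \<open>T'\<close> is the inverse of the triangulator.\<close>

definition fold_cut :: "'o \<Rightarrow> 'c \<Rightarrow> 'c \<Rightarrow> 'c"
  where "fold_cut \<alpha> T' g = \<T> \<alpha> \<cdot> (((g \<unlhd> \<alpha>) \<bullet> \<iota> (\<alpha> \<triangleright> \<eta> (\<alpha>\<sharp>))) \<cdot> T')"

lemma fold_cut:
  assumes a: "\<alpha> \<in> Obj B"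
    and T': "T' \<in> carrier (\<H> (\<I> \<alpha>) (((\<eta> \<alpha>)\<dagger> \<triangleleft> \<alpha>) \<star> (\<alpha> \<triangleright> \<eta> (\<alpha>\<sharp>))))"
      "T' \<cdot> \<T> \<alpha> = \<iota> (((\<eta> \<alpha>)\<dagger> \<triangleleft> \<alpha>) \<star> (\<alpha> \<triangleright> \<eta> (\<alpha>\<sharp>)))" "\<T> \<alpha> \<cdot> T' = \<iota> (\<I> \<alpha>)"
  shows fold_cut_cell: "cell (\<alpha> \<box> \<alpha>\<sharp>) \<O> ((\<eta> \<alpha>)\<dagger>) ((\<eta> \<alpha>)\<dagger>) g \<Longrightarrow>
      cell \<alpha> \<alpha> (\<I> \<alpha>) (\<I> \<alpha>) (fold_cut \<alpha> T' g)"
    and fold_cut_cofold_End: "cell \<alpha> \<alpha> (\<I> \<alpha>) (\<I> \<alpha>) \<phi> \<Longrightarrow> fold_cut \<alpha> T' (cofold_End \<alpha> \<phi>) = \<phi>"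
    and cofold_End_fold_cut: "cell (\<alpha> \<box> \<alpha>\<sharp>) \<O> ((\<eta> \<alpha>)\<dagger>) ((\<eta> \<alpha>)\<dagger>) g \<Longrightarrow>
      cofold_End \<alpha> (fold_cut \<alpha> T' g) = g"
proof -
  let ?b = "\<alpha>\<sharp>" and ?e = "(\<eta> \<alpha>)\<dagger>"
  have b: "?b \<in> Obj B" and bb: "?b\<sharp> = \<alpha>" using a dual_obj dual_dual by auto
  note O = unit_obj and ab = box_obj[OF a b] and ba = box_obj[OF b a]
  have box: "\<alpha> \<box> (?b \<box> \<alpha>) \<in> Obj B" "(\<alpha> \<box> ?b) \<box> \<alpha> = \<alpha> \<box> (?b \<box> \<alpha>)"
    "\<O> \<box> \<alpha> = \<alpha>" "\<alpha> \<box> \<O> = \<alpha>" "\<O> \<box> ?b = ?b" "?b \<box> \<O> = ?b"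
    "(?b \<box> \<alpha>) \<box> ?b = ?b \<box> (\<alpha> \<box> ?b)" "(\<alpha> \<box> ?b) \<box> \<O> = \<alpha> \<box> ?b" "\<O> \<box> (\<alpha> \<box> ?b) = \<alpha> \<box> ?b"
    using a b by (simp_all add: box_obj box_assoc box_unit_left box_unit_right)
  have bab: "?b \<box> (\<alpha> \<box> ?b) \<in> Obj B" "\<alpha> \<box> (?b \<box> (\<alpha> \<box> ?b)) \<in> Obj B" using a b by (simp_all add: box_obj)
  have h: "\<eta> ?b \<in> \<B> \<O> (?b \<box> \<alpha>)" using fold_mor[OF b] bb by auto
  have e: "?e \<in> \<B> (\<alpha> \<box> ?b) \<O>" by (rule dagger_mor[OF O ab fold_mor[OF a]])
  note Ia = id1_mor[OF a] and Iab = id1_mor[OF ab]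
  define U where "U = ?e \<triangleleft> \<alpha>"
  define Z where "Z = \<alpha> \<triangleright> \<eta> ?b"
  have U: "U \<in> \<B> (\<alpha> \<box> (?b \<box> \<alpha>)) \<alpha>" using rwhisker1_mor[OF a ab O e] box by (simp add: U_def)
  have Z: "Z \<in> \<B> \<alpha> (\<alpha> \<box> (?b \<box> \<alpha>))" using lwhisker1_mor[OF a O ba h] box by (simp add: Z_def)
  note UZ = hcomp1_mor[OF a box(1) a Z U] and iU = cell_id[OF box(1) a U] and iZ = cell_id[OF a box(1) Z]
  note ie = cell_id[OF ab O e]
  have T: "cell \<alpha> \<alpha> (U \<star> Z) (\<I> \<alpha>) (\<T> \<alpha>)"
    using triangulator_iso[OF a] UZ Ia a by (simp add: iso2_def cell_def U_def Z_def)
  have T'c: "cell \<alpha> \<alpha> (\<I> \<alpha>) (U \<star> Z) T'"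
    using T' UZ Ia a by (simp add: cell_def U_def Z_def)
  have mid: "cell \<alpha> \<alpha> (U \<star> Z) (U \<star> Z) ((g \<unlhd> \<alpha>) \<bullet> \<iota> Z)" if "cell (\<alpha> \<box> ?b) \<O> ?e ?e g" for g
    using cell_hcomp[OF iZ] cell_rwhisker[OF a that] box by (simp add: U_def)
  show cell: "cell \<alpha> \<alpha> (\<I> \<alpha>) (\<I> \<alpha>) (fold_cut \<alpha> T' g)" if "cell (\<alpha> \<box> ?b) \<O> ?e ?e g" for g
    using cell_vcomp[OF cell_vcomp[OF T'c mid[OF that]] T] by (simp add: fold_cut_def Z_def)
  show "fold_cut \<alpha> T' (cofold_End \<alpha> \<phi>) = \<phi>" if \<phi>: "cell \<alpha> \<alpha> (\<I> \<alpha>) (\<I> \<alpha>) \<phi>"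
  proof -
    have \<phi>ba: "cell (\<alpha> \<box> (?b \<box> \<alpha>)) (\<alpha> \<box> (?b \<box> \<alpha>)) (\<I> (\<alpha> \<box> (?b \<box> \<alpha>))) (\<I> (\<alpha> \<box> (?b \<box> \<alpha>))) (\<phi> \<unlhd> (?b \<box> \<alpha>))"
      using cell_rwhisker[OF ba \<phi>] rwhisker1_id1[OF ba a] by simp
    have \<phi>b: "cell (\<alpha> \<box> ?b) (\<alpha> \<box> ?b) (\<I> (\<alpha> \<box> ?b)) (\<I> (\<alpha> \<box> ?b)) (\<phi> \<unlhd> ?b)"
      using cell_rwhisker[OF b \<phi>] rwhisker1_id1[OF b a] by simp
    have "(cofold_End \<alpha> \<phi> \<unlhd> \<alpha>) \<bullet> \<iota> Z = (\<iota> U \<bullet> (\<phi> \<unlhd> (?b \<box> \<alpha>))) \<bullet> \<iota> Z"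
      using rwhisker2_hcomp2[OF a ab ab O Iab Iab e e, of "\<phi> \<unlhd> ?b" "\<iota> ?e"] \<phi>b ie \<phi>
        rwhisker2_id2[OF a ab O e] whisker2_assoc[OF b a a a Ia Ia]
      by (simp add: cofold_End_def U_def cell_def)
    also have "\<dots> = \<iota> U \<bullet> ((\<phi> \<unlhd> (?b \<box> \<alpha>)) \<bullet> \<iota> Z)"
      by (rule hcomp_assoc'[OF iZ \<phi>ba iU])
    \<comment> \<open>Naturality of the interchange for \<open>\<I> \<alpha>\<close> and the fold:
      at \<open>\<I> \<alpha>\<close> the interchange is an identity, so \<phi> passes from one side
      of \<open>Z\<close> to the other.\<close>
    also have "(\<phi> \<unlhd> (?b \<box> \<alpha>)) \<bullet> \<iota> Z = \<iota> Z \<bullet> \<phi>"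
      using interchange_natural[OF a a O ba Ia Ia h h, of \<phi> "\<iota> (\<eta> ?b)"] \<phi> cell_id[OF O ba h]
        lwhisker2_id2[OF a O ba h] interchange_id_left[OF a O ba h] whisker2_unit[OF a a Ia Ia]
        vcomp_id_right[OF cell_hcomp[OF \<phi> iZ]] vcomp_id_left[OF cell_hcomp[OF iZ \<phi>ba]]
        hcomp1_unit_left[OF a box(1) Z] hcomp1_unit_right[OF a box(1) Z]
      by (simp add: cell_def Z_def)
    also have "\<iota> U \<bullet> (\<iota> Z \<bullet> \<phi>) = \<iota> (U \<star> Z) \<bullet> \<phi>"
      using hcomp_assoc'[OF \<phi> iZ iU] id_hcomp[OF a box(1) a Z U] by simp
    finally have "fold_cut \<alpha> T' (cofold_End \<alpha> \<phi>) = \<T> \<alpha> \<cdot> ((\<iota> (U \<star> Z) \<bullet> \<phi>) \<cdot> T')"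
      by (simp add: fold_cut_def Z_def)
    also have "\<dots> = (\<T> \<alpha> \<cdot> (\<iota> (U \<star> Z) \<bullet> \<phi>)) \<cdot> T'"
      using vcomp_assoc'[OF T'c _ T] cell_hcomp[OF \<phi> cell_id[OF a a UZ]] hcomp1_unit_right[OF a a UZ]
      by simp
    \<comment> \<open>Both sides are \<open>\<T> \<alpha> \<bullet> \<phi>\<close>.\<close>
    also have "\<T> \<alpha> \<cdot> (\<iota> (U \<star> Z) \<bullet> \<phi>) = \<phi> \<cdot> \<T> \<alpha>"
      using hcomp_left_right[OF \<phi> T] hcomp_right_left[OF \<phi> T] hcomp_id_right[OF T] hcomp_id_left[OF \<phi>]
      by simp
    also have "(\<phi> \<cdot> \<T> \<alpha>) \<cdot> T' = \<phi>"
      using vcomp_assoc'[OF T'c T \<phi>] T'(3) vcomp_id_right[OF \<phi>] by simp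
    finally show ?thesis .
  qed
  show "cofold_End \<alpha> (fold_cut \<alpha> T' g) = g" if g: "cell (\<alpha> \<box> ?b) \<O> ?e ?e g"
  proof -
    \<comment> \<open>These are the factors of the swallowtail identity, which becomes
      \<open>w \<cdot> (s \<cdot> (\<iota> ?e \<bullet> m)) = \<iota> ?e\<close>. \<open>R\<close>
      and \<open>S\<close> are the cofold whiskered on the left and on the right by
      \<open>\<alpha> \<box> ?b\<close>; the interchange \<open>\<sigma> ?e ?e\<close> goes from
      \<open>?e \<star> R\<close> to \<open>?e \<star> S\<close>.\<close>
    define Q where "Q = \<alpha> \<triangleright> (\<eta> ?b \<triangleleft> ?b)"
    define R where "R = (\<alpha> \<box> ?b) \<triangleright> ?e"
    define S where "S = ?e \<triangleleft> (\<alpha> \<box> ?b)"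
    define s where "s = \<sigma> ?e ?e \<bullet> \<iota> Q"
    define m where "m = \<alpha> \<unrhd> triangulator_mate B ?b"
    define w where "w = \<iota> ?e \<bullet> (\<T> \<alpha> \<unlhd> ?b)"
    define w' where "w' = \<iota> ?e \<bullet> (T' \<unlhd> ?b)"
    let ?D = "\<alpha> \<box> ?b" and ?DD = "\<alpha> \<box> (?b \<box> (\<alpha> \<box> ?b))"
    have DD: "?D \<box> ?D = ?DD" "(\<alpha> \<box> (?b \<box> \<alpha>)) \<box> ?b = ?DD" using a b by (simp_all add: box_obj box_assoc)
    have Q: "Q \<in> \<B> ?D ?DD"
      using lwhisker1_mor[OF a b bab(1)] rwhisker1_mor[OF b O ba h] box by (simp add: Q_def)
    have R: "R \<in> \<B> ?DD ?D" using lwhisker1_mor[OF ab ab O e] box DD by (simp add: R_def)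
    have S: "S \<in> \<B> ?DD ?D" using rwhisker1_mor[OF ab ab O e] box DD by (simp add: S_def)
    note iQ = cell_id[OF ab bab(2) Q] and iR = cell_id[OF bab(2) ab R]
    note RQ = hcomp1_mor[OF ab bab(2) ab Q R] and SQ = hcomp1_mor[OF ab bab(2) ab Q S]
    have UZb: "(U \<star> Z) \<triangleleft> ?b = S \<star> Q"
      using rwhisker1_hcomp1[OF b a box(1) a Z U] whisker1_assoc[OF a b ab O e] whisker1_assoc[OF a b O ba h]
      by (simp add: U_def Z_def S_def Q_def)
    have swallow: "w \<cdot> (s \<cdot> (\<iota> ?e \<bullet> m)) = \<iota> ?e"
      using swallowtail[OF a] by (simp add: w_def s_def m_def Q_def)
    have Tb: "cell ?D ?D (S \<star> Q) (\<I> ?D) (\<T> \<alpha> \<unlhd> ?b)" and T'b: "cell ?D ?D (\<I> ?D) (S \<star> Q) (T' \<unlhd> ?b)"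
      using cell_rwhisker[OF b T] cell_rwhisker[OF b T'c] by (simp_all add: UZb rwhisker1_id1[OF b a])
    have w: "cell ?D \<O> (?e \<star> (S \<star> Q)) ?e w" and w': "cell ?D \<O> ?e (?e \<star> (S \<star> Q)) w'"
      using cell_hcomp[OF Tb ie] cell_hcomp[OF T'b ie]
      by (simp_all add: w_def w'_def hcomp1_unit_right[OF ab O e])
    have "(T' \<unlhd> ?b) \<cdot> (\<T> \<alpha> \<unlhd> ?b) = \<iota> (S \<star> Q)"
      using rwhisker2_vcomp[OF b a a UZ Ia UZ, of "\<T> \<alpha>" T'] rwhisker2_id2[OF b a a UZ] T T'c T'(2) UZb
      by (simp add: cell_def U_def[symmetric] Z_def[symmetric])
    then have w'w: "w' \<cdot> w = \<iota> (?e \<star> (S \<star> Q))"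
      using whisker_left_vcomp[OF Tb T'b ie] id_hcomp[OF ab ab O SQ e] by (simp add: w_def w'_def)
    have "cell ?b ?b (\<I> ?b) ((?b \<triangleright> ?e) \<star> (\<eta> ?b \<triangleleft> ?b)) (triangulator_mate B ?b)"
      using cell_triangulator_mate[OF b] by (simp add: bb)
    from cell_lwhisker[OF a this]
    have m: "cell ?D ?D (\<I> ?D) (R \<star> Q) m"
      using lwhisker1_hcomp1[OF a b bab(1) b, of "\<eta> ?b \<triangleleft> ?b" "?b \<triangleright> ?e"] box
        rwhisker1_mor[OF b O ba h] lwhisker1_mor[OF b ab O e] whisker1_assoc[OF a b ab O e]
      by (simp add: m_def R_def Q_def lwhisker1_id1[OF a b])
    have em: "cell ?D \<O> ?e (?e \<star> (R \<star> Q)) (\<iota> ?e \<bullet> m)"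
      using cell_hcomp[OF m ie] by (simp add: hcomp1_unit_right[OF ab O e])
    have \<sigma>c: "cell ?DD \<O> (?e \<star> R) (?e \<star> S) (\<sigma> ?e ?e)"
      using interchange_iso[OF ab O ab O e e] hcomp1_mor[OF bab(2) ab O R e]
        hcomp1_mor[OF bab(2) ab O S e] bab O whisker1_unit[OF ab O e]
      by (simp add: iso2_def cell_def R_def S_def)
    have s: "cell ?D \<O> (?e \<star> (R \<star> Q)) (?e \<star> (S \<star> Q)) s"
      using cell_hcomp[OF iQ \<sigma>c] hcomp1_assoc[OF ab bab(2) ab O Q R e]
        hcomp1_assoc[OF ab bab(2) ab O Q S e] by (simp add: s_def)
    \<comment> \<open>By the swallowtail identity \<open>s \<cdot> (1 \<bullet> m)\<close> is a right inverse of the isomorphism \<open>w\<close>.\<close>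
    have w'_eq: "w' = s \<cdot> (\<iota> ?e \<bullet> m)"
      using vcomp_assoc'[OF cell_vcomp[OF em s] w w'] w'w swallow
        vcomp_id_left[OF cell_vcomp[OF em s]] vcomp_id_right[OF w'] by simp
    have gab: "cell ?DD ?D S S (g \<unlhd> ?D)" using cell_rwhisker[OF ab g] by (simp add: DD S_def box)
    have gR: "cell ?DD \<O> (?e \<star> R) (?e \<star> R) (g \<bullet> \<iota> R)" by (rule cell_hcomp[OF iR g])
    have egab: "cell ?DD \<O> (?e \<star> S) (?e \<star> S) (\<iota> ?e \<bullet> (g \<unlhd> ?D))" by (rule cell_hcomp[OF gab ie])
    \<comment> \<open>Naturality in the first argument alone: \<open>g\<close> on the whiskered
      cofold \<open>S\<close> after the interchange is \<open>g\<close> on the outer cofold before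
      it.\<close>
    have nat: "\<sigma> ?e ?e \<cdot> (g \<bullet> \<iota> R) = (\<iota> ?e \<bullet> (g \<unlhd> ?D)) \<cdot> \<sigma> ?e ?e"
      using interchange_natural[OF ab O ab O e e e e, of g "\<iota> ?e"] g ie lwhisker2_id2[OF ab ab O e]
        whisker2_unit[OF ab O e e]
      by (simp add: cell_def R_def)
    have gmid: "cell \<alpha> \<alpha> (\<I> \<alpha>) (U \<star> Z) (((g \<unlhd> \<alpha>) \<bullet> \<iota> Z) \<cdot> T')" by (rule cell_vcomp[OF T'c mid[OF g]])
    have ga: "cell (\<alpha> \<box> (?b \<box> \<alpha>)) \<alpha> U U (g \<unlhd> \<alpha>)" using cell_rwhisker[OF a g] by (simp add: U_def box)
    have gQ: "cell ?D ?D (S \<star> Q) (S \<star> Q) ((g \<unlhd> ?D) \<bullet> \<iota> Q)" by (rule cell_hcomp[OF iQ gab])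
    have "(((g \<unlhd> \<alpha>) \<bullet> \<iota> Z) \<cdot> T') \<unlhd> ?b = (((g \<unlhd> \<alpha>) \<bullet> \<iota> Z) \<unlhd> ?b) \<cdot> (T' \<unlhd> ?b)"
      using rwhisker2_vcomp[OF b a a Ia UZ UZ] T'c mid[OF g] by (simp add: cell_def)
    also have "((g \<unlhd> \<alpha>) \<bullet> \<iota> Z) \<unlhd> ?b = (g \<unlhd> ?D) \<bullet> \<iota> Q"
      using rwhisker2_hcomp2[OF b a box(1) a Z Z U U] iZ ga g rwhisker2_id2[OF b a box(1) Z]
        whisker2_assoc[OF a b ab O e e] whisker1_assoc[OF a b O ba h]
      by (simp add: cell_def Z_def Q_def)
    finally have "cofold_End \<alpha> (fold_cut \<alpha> T' g) = \<iota> ?e \<bullet> ((\<T> \<alpha> \<unlhd> ?b) \<cdot> (((g \<unlhd> ?D) \<bullet> \<iota> Q) \<cdot> (T' \<unlhd> ?b)))"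
      using rwhisker2_vcomp[OF b a a Ia UZ Ia] T gmid
      by (simp add: cofold_End_def fold_cut_def Z_def cell_def)
    also have "\<dots> = w \<cdot> ((\<iota> ?e \<bullet> ((g \<unlhd> ?D) \<bullet> \<iota> Q)) \<cdot> w')"
      using whisker_left_vcomp[OF cell_vcomp[OF T'b gQ] Tb ie] whisker_left_vcomp[OF T'b gQ ie]
      by (simp add: w_def w'_def)
    \<comment> \<open>In the form \<open>s \<cdot> (\<iota> ?e \<bullet> m)\<close> the 2-morphism
      \<open>w'\<close> lets \<open>g\<close> through: the interchange moves it to the outer cofold,
      which \<open>m\<close> does not touch, so it slides past \<open>m\<close> and ends up applied
      first.\<close>
    also have "(\<iota> ?e \<bullet> ((g \<unlhd> ?D) \<bullet> \<iota> Q)) \<cdot> w' = s \<cdot> ((\<iota> ?e \<bullet> m) \<cdot> g)"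
    proof -
      have X: "\<iota> ?e \<bullet> ((g \<unlhd> ?D) \<bullet> \<iota> Q) = (\<iota> ?e \<bullet> (g \<unlhd> ?D)) \<bullet> \<iota> Q"
        using hcomp_assoc'[OF iQ gab ie] by simp
      have "(\<iota> ?e \<bullet> ((g \<unlhd> ?D) \<bullet> \<iota> Q)) \<cdot> w' = ((\<iota> ?e \<bullet> ((g \<unlhd> ?D) \<bullet> \<iota> Q)) \<cdot> s) \<cdot> (\<iota> ?e \<bullet> m)"
        using vcomp_assoc'[OF em s cell_hcomp[OF gQ ie]] by (simp add: w'_eq)
      also have "(\<iota> ?e \<bullet> ((g \<unlhd> ?D) \<bullet> \<iota> Q)) \<cdot> s = s \<cdot> ((g \<bullet> \<iota> R) \<bullet> \<iota> Q)"
        using whisker_right_vcomp[OF \<sigma>c egab iQ] whisker_right_vcomp[OF gR \<sigma>c iQ] nat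
        by (simp add: s_def X)
      also have "(g \<bullet> \<iota> R) \<bullet> \<iota> Q = g \<bullet> \<iota> (R \<star> Q)"
        using hcomp_assoc'[OF iQ iR g] id_hcomp[OF ab bab(2) ab Q R] by simp
      also have "(s \<cdot> (g \<bullet> \<iota> (R \<star> Q))) \<cdot> (\<iota> ?e \<bullet> m) = s \<cdot> ((g \<bullet> \<iota> (R \<star> Q)) \<cdot> (\<iota> ?e \<bullet> m))"
        by (rule vcomp_assoc'[OF em cell_hcomp[OF cell_id[OF ab ab RQ] g] s])
      also have "(g \<bullet> \<iota> (R \<star> Q)) \<cdot> (\<iota> ?e \<bullet> m) = (\<iota> ?e \<bullet> m) \<cdot> g"
        using hcomp_left_right[OF m g] hcomp_right_left[OF m g] hcomp_id_right[OF g] by simp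
      finally show ?thesis .
    qed
    also have "w \<cdot> (s \<cdot> ((\<iota> ?e \<bullet> m) \<cdot> g)) = (w \<cdot> (s \<cdot> (\<iota> ?e \<bullet> m))) \<cdot> g"
      using vcomp_assoc'[OF g em s] vcomp_assoc'[OF g cell_vcomp[OF em s] w] by simp
    also have "\<dots> = g" using swallow vcomp_id_left[OF g] by simp
    finally show ?thesis .
  qed
qed

lemma cofold_End_bij:
  assumes a: "\<alpha> \<in> Obj B"
  shows "bij_betw (cofold_End \<alpha>) (carrier (\<H> (\<I> \<alpha>) (\<I> \<alpha>))) (carrier (\<H> ((\<eta> \<alpha>)\<dagger>) ((\<eta> \<alpha>)\<dagger>)))"
proof -
  from triangulator_iso[OF a] obtain T'
    where T': "T' \<in> carrier (\<H> (\<I> \<alpha>) (((\<eta> \<alpha>)\<dagger> \<triangleleft> \<alpha>) \<star> (\<alpha> \<triangleright> \<eta> (\<alpha>\<sharp>))))"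
      "T' \<cdot> \<T> \<alpha> = \<iota> (((\<eta> \<alpha>)\<dagger> \<triangleleft> \<alpha>) \<star> (\<alpha> \<triangleright> \<eta> (\<alpha>\<sharp>)))" "\<T> \<alpha> \<cdot> T' = \<iota> (\<I> \<alpha>)"
    unfolding iso2_def by blast
  have ab: "\<alpha> \<box> \<alpha>\<sharp> \<in> Obj B" using a dual_obj box_obj by blast
  have \<phi>: "cell \<alpha> \<alpha> (\<I> \<alpha>) (\<I> \<alpha>) \<phi>" if "\<phi> \<in> carrier (\<H> (\<I> \<alpha>) (\<I> \<alpha>))" for \<phi>
    using that a id1_mor by (simp add: cell_def)
  have \<psi>: "cell (\<alpha> \<box> \<alpha>\<sharp>) \<O> ((\<eta> \<alpha>)\<dagger>) ((\<eta> \<alpha>)\<dagger>) g" if "g \<in> carrier (\<H> ((\<eta> \<alpha>)\<dagger>) ((\<eta> \<alpha>)\<dagger>))" for g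
    using that ab unit_obj dagger_mor[OF unit_obj ab fold_mor[OF a]] by (simp add: cell_def)
  show ?thesis
  proof (rule bij_betw_byWitness[where f' = "fold_cut \<alpha> T'"])
    show "\<forall>\<phi>\<in>carrier (\<H> (\<I> \<alpha>) (\<I> \<alpha>)). fold_cut \<alpha> T' (cofold_End \<alpha> \<phi>) = \<phi>"
      using fold_cut_cofold_End[OF a T' \<phi>] by blast
    show "\<forall>g\<in>carrier (\<H> ((\<eta> \<alpha>)\<dagger>) ((\<eta> \<alpha>)\<dagger>)). cofold_End \<alpha> (fold_cut \<alpha> T' g) = g"
      using cofold_End_fold_cut[OF a T' \<psi>] by blast
    show "cofold_End \<alpha> ` carrier (\<H> (\<I> \<alpha>) (\<I> \<alpha>)) \<subseteq> carrier (\<H> ((\<eta> \<alpha>)\<dagger>) ((\<eta> \<alpha>)\<dagger>))"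
      using cell_cofold_End[OF a \<phi>] by (auto simp: cell_def)
    show "fold_cut \<alpha> T' ` carrier (\<H> ((\<eta> \<alpha>)\<dagger>) ((\<eta> \<alpha>)\<dagger>)) \<subseteq> carrier (\<H> (\<I> \<alpha>) (\<I> \<alpha>))"
      using fold_cut_cell[OF a T' \<psi>] by (auto simp: cell_def)
  qed
qed

end

section \<open>The Frobenius algebra\<close>

lemma abelian_group_mult_one_update: "abelian_group M \<Longrightarrow> abelian_group (M\<lparr>mult := m, one := e\<rparr>)"
  by (simp add: abelian_group_def abelian_monoid_def abelian_group_axioms_def)

context linear_2category
begin

lemma carrier_End_algebra [simp]:
  "carrier (End_algebra B X) = carrier (\<H> X X)" "add (End_algebra B X) = add (\<H> X X)"
  "smult (End_algebra B X) = smult (\<H> X X)" "zero (End_algebra B X) = zero (\<H> X X)"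
  "mult (End_algebra B X) = (\<cdot>)" "one (End_algebra B X) = \<iota> X"
  by (simp_all add: End_algebra_def)

lemma algebra_End_id:
  assumes a: "\<alpha> \<in> Obj B"
  shows "algebra K (End_algebra B (\<I> \<alpha>))"
proof -
  note I = id1_mor[OF a]
  interpret K: field K by (rule field)
  interpret M: module K "\<H> (\<I> \<alpha>) (\<I> \<alpha>)" by (rule vector_space[OF a a I I])
  have closed: "\<psi> \<cdot> \<phi> \<in> carrier (\<H> (\<I> \<alpha>) (\<I> \<alpha>))"
    if "\<phi> \<in> carrier (\<H> (\<I> \<alpha>) (\<I> \<alpha>))" "\<psi> \<in> carrier (\<H> (\<I> \<alpha>) (\<I> \<alpha>))" for \<phi> \<psi>
    using linear_map_closed[OF vcomp_linear_left[OF a a I I I that(1)] that(2)] .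
  have ab: "abelian_group (End_algebra B (\<I> \<alpha>))"
    unfolding End_algebra_def by (rule abelian_group_mult_one_update[OF M.abelian_group_axioms])
  have "comm_monoid (End_algebra B (\<I> \<alpha>))"
    by (rule comm_monoidI)
      (auto simp: closed id2_hom[OF a a I] vcomp_assoc[OF a a I I I I] vcomp_unit_left[OF a a I I]
        intro: End_id_commute[OF a])
  then have "cring (End_algebra B (\<I> \<alpha>))"
    using ab linear_map_add[OF vcomp_linear_left[OF a a I I I]] by (intro cringI) simp_all
  then show ?thesis
    using linear_map_smult[OF vcomp_linear_left[OF a a I I I]]
    by (intro algebraI) (simp_all add: K.is_cring M.smult_l_distr M.smult_r_distr M.smult_assoc1)
qed

end

context linear_pivotal_2category
begin

text \<open>The transpose along the right adjunction; each of its two zigzag identities accounts for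
  one of the two composites.\<close>

lemma coev_tilde_hcomp_bij:
  assumes X: "\<alpha> \<in> Obj B" "\<beta> \<in> Obj B" "X \<in> \<B> \<alpha> \<beta>"
  shows "bij_betw (\<lambda>g. (g \<bullet> \<iota> X) \<cdot> coev_tilde B X)
    (carrier (\<H> (X\<dagger>) (X\<dagger>))) (carrier (\<H> (\<I> \<alpha>) (X\<dagger> \<star> X)))"
proof (rule bij_betw_byWitness[where f' = "\<lambda>w. (\<iota> (X\<dagger>) \<bullet> ev_tilde B X) \<cdot> (w \<bullet> \<iota> (X\<dagger>))"])
  note D = dagger_mor[OF X] and p = cell_pivotal[OF X]
  have g: "cell \<beta> \<alpha> (X\<dagger>) (X\<dagger>) g" if "g \<in> carrier (\<H> (X\<dagger>) (X\<dagger>))" for g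
    using that X D by (simp add: cell_def)
  have w: "cell \<alpha> \<alpha> (\<I> \<alpha>) (X\<dagger> \<star> X) w" if "w \<in> carrier (\<H> (\<I> \<alpha>) (X\<dagger> \<star> X))" for w
    using that cell_idE(2)[OF p(5)] cell_idE(1)[OF p(5)] by (simp add: cell_def)
  have ass: "(X\<dagger> \<star> X) \<star> X\<dagger> = X\<dagger> \<star> (X \<star> X\<dagger>)" "X\<dagger> \<star> \<I> \<beta> = X\<dagger>" "\<I> \<alpha> \<star> X\<dagger> = X\<dagger>"
    using X D hcomp1_assoc[OF X(2,1,2,1)] hcomp1_unit_right[OF X(2,1)]
      hcomp1_unit_left[OF X(2,1)] by simp_all
  show "\<forall>g\<in>carrier (\<H> (X\<dagger>) (X\<dagger>)).
      (\<iota> (X\<dagger>) \<bullet> ev_tilde B X) \<cdot> (((g \<bullet> \<iota> X) \<cdot> coev_tilde B X) \<bullet> \<iota> (X\<dagger>)) = g"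
    using coev_tilde_hcomp_inverse[OF X g] by blast
  show "\<forall>w\<in>carrier (\<H> (\<I> \<alpha>) (X\<dagger> \<star> X)).
      (((\<iota> (X\<dagger>) \<bullet> ev_tilde B X) \<cdot> (w \<bullet> \<iota> (X\<dagger>))) \<bullet> \<iota> X) \<cdot> coev_tilde B X = w"
    using coev_tilde_hcomp_inverse'[OF X w] by blast
  show "(\<lambda>g. (g \<bullet> \<iota> X) \<cdot> coev_tilde B X) ` carrier (\<H> (X\<dagger>) (X\<dagger>)) \<subseteq> carrier (\<H> (\<I> \<alpha>) (X\<dagger> \<star> X))"
    using cell_vcomp[OF p(5) cell_hcomp[OF cell_id[OF X] g]] by (auto simp: cell_def)
  have "cell \<beta> \<alpha> (X\<dagger>) (X\<dagger>) ((\<iota> (X\<dagger>) \<bullet> ev_tilde B X) \<cdot> (w \<bullet> \<iota> (X\<dagger>)))"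
    if "w \<in> carrier (\<H> (\<I> \<alpha>) (X\<dagger> \<star> X))" for w
    using cell_vcomp[of \<beta> \<alpha>, OF cell_hcomp[OF p(1) w[OF that]]] cell_hcomp[OF p(4,1)]
    by (simp add: ass)
  then show "(\<lambda>w. (\<iota> (X\<dagger>) \<bullet> ev_tilde B X) \<cdot> (w \<bullet> \<iota> (X\<dagger>))) ` carrier (\<H> (\<I> \<alpha>) (X\<dagger> \<star> X))
      \<subseteq> carrier (\<H> (X\<dagger>) (X\<dagger>))"
    by (auto simp: cell_def)
qed

end

section \<open>The pairing as composition through the 1-morphism V, and its nondegeneracy\<close>

context monoidal_2category_with_duals
begin

text \<open>The transpose of \<open>cofold_End \<alpha> \<phi>\<close> in Hom(1, V) along the right
  adjunction; \<open>cofold_ev\<close> below is its transpose in Hom(V, 1) along the left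
  one.\<close>

definition cofold_coev :: "'o \<Rightarrow> 'c \<Rightarrow> 'c"
  where "cofold_coev \<alpha> \<phi> = (cofold_End \<alpha> \<phi> \<bullet> \<iota> (\<eta> \<alpha>)) \<cdot> coev_tilde B (\<eta> \<alpha>)"

definition cofold_ev :: "'o \<Rightarrow> 'c \<Rightarrow> 'c"
  where "cofold_ev \<alpha> \<phi> = ev B (\<eta> \<alpha>) \<cdot> (cofold_End \<alpha> \<phi> \<bullet> \<iota> (\<eta> \<alpha>))"

lemma fold_obj_mor:
  assumes "\<alpha> \<in> Obj B"
  shows "\<alpha> \<box> \<alpha>\<sharp> \<in> Obj B" "\<eta> \<alpha> \<in> \<B> \<O> (\<alpha> \<box> \<alpha>\<sharp>)" "(\<eta> \<alpha>)\<dagger> \<in> \<B> (\<alpha> \<box> \<alpha>\<sharp>) \<O>"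
    "(\<eta> \<alpha>)\<dagger> \<star> \<eta> \<alpha> \<in> \<B> \<O> \<O>"
proof -
  show D: "\<alpha> \<box> \<alpha>\<sharp> \<in> Obj B" using assms dual_obj box_obj by blast
  show "\<eta> \<alpha> \<in> \<B> \<O> (\<alpha> \<box> \<alpha>\<sharp>)" using fold_mor[OF assms] .
  then show "(\<eta> \<alpha>)\<dagger> \<in> \<B> (\<alpha> \<box> \<alpha>\<sharp>) \<O>" by (rule dagger_mor[OF unit_obj D])
  then show "(\<eta> \<alpha>)\<dagger> \<star> \<eta> \<alpha> \<in> \<B> \<O> \<O>"
    using hcomp1_mor[OF unit_obj D unit_obj] fold_mor[OF assms] by blast
qed

lemma cofold_linear:
  assumes a: "\<alpha> \<in> Obj B"
  shows "linear_map K (\<H> (\<I> \<alpha>) (\<I> \<alpha>)) (\<H> ((\<eta> \<alpha>)\<dagger> \<star> \<eta> \<alpha>) ((\<eta> \<alpha>)\<dagger> \<star> \<eta> \<alpha>))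
      (\<lambda>\<phi>. cofold_End \<alpha> \<phi> \<bullet> \<iota> (\<eta> \<alpha>))"
    and cofold_coev_linear: "linear_map K (\<H> (\<I> \<alpha>) (\<I> \<alpha>)) (\<H> (\<I> \<O>) ((\<eta> \<alpha>)\<dagger> \<star> \<eta> \<alpha>)) (cofold_coev \<alpha>)"
    and cofold_ev_linear: "linear_map K (\<H> (\<I> \<alpha>) (\<I> \<alpha>)) (\<H> ((\<eta> \<alpha>)\<dagger> \<star> \<eta> \<alpha>) (\<I> \<O>)) (cofold_ev \<alpha>)"
proof -
  note b = dual_obj[OF a] and O = unit_obj and f = fold_obj_mor[OF a]
  note I = id1_mor[OF a] and ID = id1_mor[OF f(1)] and IO = id1_mor[OF O]
  note p = cell_pivotal[OF O f(1,2)]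
  have "linear_map K (\<H> (\<I> \<alpha>) (\<I> \<alpha>)) (\<H> ((\<eta> \<alpha>)\<dagger>) ((\<eta> \<alpha>)\<dagger>)) (cofold_End \<alpha>)"
    using linear_map_compose[OF rwhisker2_linear[OF b a a I I, unfolded rwhisker1_id1[OF b a]]
        hcomp2_linear_right[OF f(1,1) O ID ID f(3,3) id2_hom[OF f(1) O f(3)]]]
      hcomp1_unit_right[OF f(1) O f(3)] by (simp add: cofold_End_def[abs_def])
  then show lin: "linear_map K (\<H> (\<I> \<alpha>) (\<I> \<alpha>)) (\<H> ((\<eta> \<alpha>)\<dagger> \<star> \<eta> \<alpha>) ((\<eta> \<alpha>)\<dagger> \<star> \<eta> \<alpha>))
      (\<lambda>\<phi>. cofold_End \<alpha> \<phi> \<bullet> \<iota> (\<eta> \<alpha>))"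
    by (rule linear_map_compose) (rule hcomp2_linear_left[OF O f(1) O f(2,2,3,3) id2_hom[OF O f(1,2)]])
  show "linear_map K (\<H> (\<I> \<alpha>) (\<I> \<alpha>)) (\<H> (\<I> \<O>) ((\<eta> \<alpha>)\<dagger> \<star> \<eta> \<alpha>)) (cofold_coev \<alpha>)"
    unfolding cofold_coev_def[abs_def]
    by (rule linear_map_compose[OF lin vcomp_linear_left[OF O O IO f(4,4)]]) (use p(5) in \<open>simp add: cell_def\<close>)
  show "linear_map K (\<H> (\<I> \<alpha>) (\<I> \<alpha>)) (\<H> ((\<eta> \<alpha>)\<dagger> \<star> \<eta> \<alpha>) (\<I> \<O>)) (cofold_ev \<alpha>)"
    unfolding cofold_ev_def[abs_def]
    by (rule linear_map_compose[OF lin vcomp_linear_right[OF O O f(4,4) IO]]) (use p(2) in \<open>simp add: cell_def\<close>)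
qed

lemma cofold_coev_bij:
  assumes a: "\<alpha> \<in> Obj B"
  shows "bij_betw (cofold_coev \<alpha>) (carrier (\<H> (\<I> \<alpha>) (\<I> \<alpha>))) (carrier (\<H> (\<I> \<O>) ((\<eta> \<alpha>)\<dagger> \<star> \<eta> \<alpha>)))"
  using bij_betw_trans[OF cofold_End_bij[OF a] coev_tilde_hcomp_bij[OF unit_obj fold_obj_mor(1,2)[OF a]]]
  by (simp add: cofold_coev_def[abs_def] comp_def)

text \<open>By \<open>ev_hcomp_inverse\<close> the transpose determines
  \<open>cofold_End \<alpha> \<phi>\<close>, which in turn determines \<phi>.\<close>

lemma cofold_ev_inj:
  assumes a: "\<alpha> \<in> Obj B"
  shows "inj_on (cofold_ev \<alpha>) (carrier (\<H> (\<I> \<alpha>) (\<I> \<alpha>)))"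
proof (rule inj_onI)
  fix \<phi> \<psi> assume *: "\<phi> \<in> carrier (\<H> (\<I> \<alpha>) (\<I> \<alpha>))" "\<psi> \<in> carrier (\<H> (\<I> \<alpha>) (\<I> \<alpha>))"
    and eq: "cofold_ev \<alpha> \<phi> = cofold_ev \<alpha> \<psi>"
  then have "cell \<alpha> \<alpha> (\<I> \<alpha>) (\<I> \<alpha>) \<phi>" "cell \<alpha> \<alpha> (\<I> \<alpha>) (\<I> \<alpha>) \<psi>"
    using a id1_mor by (simp_all add: cell_def)
  then have "cofold_End \<alpha> \<phi> = cofold_End \<alpha> \<psi>"
    using ev_hcomp_inverse[OF unit_obj fold_obj_mor(1,2)[OF a] cell_cofold_End[OF a]] eq
    unfolding cofold_ev_def by metis
  then show "\<phi> = \<psi>" using cofold_End_bij[OF a] * by (meson bij_betw_def inj_onD)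
qed

text \<open>Associativity of \<open>\<bullet>\<close> turns the whiskered \<open>tilde2\<close>
  endomorphism of V into a whiskered \<open>cofold_End\<close>, and \<open>cofold_End\<close> is
  multiplicative. The first form shows that the pairing depends only on the product of its
  arguments, which yields bilinearity and invariance. The second splits it into Hom(V, 1) and Hom(1,
  V), as nondegeneracy requires.\<close>

lemma End_pairing_cofold:
  assumes a: "\<alpha> \<in> Obj B" and \<phi>: "\<phi> \<in> carrier (\<H> (\<I> \<alpha>) (\<I> \<alpha>))" and \<psi>: "\<psi> \<in> carrier (\<H> (\<I> \<alpha>) (\<I> \<alpha>))"
  shows "End_pairing B \<alpha> \<phi> \<psi> = ev B (\<eta> \<alpha>) \<cdot> cofold_coev \<alpha> (\<phi> \<cdot> \<psi>)"
    and "End_pairing B \<alpha> \<phi> \<psi> = cofold_ev \<alpha> \<phi> \<cdot> cofold_coev \<alpha> \<psi>"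
proof -
  note b = dual_obj[OF a] and O = unit_obj and f = fold_obj_mor[OF a] and I = id1_mor[OF a]
  note p = cell_pivotal[OF O f(1,2)] and i = cell_id[OF O f(1,2)]
  have c: "cell \<alpha> \<alpha> (\<I> \<alpha>) (\<I> \<alpha>) \<phi>" "cell \<alpha> \<alpha> (\<I> \<alpha>) (\<I> \<alpha>) \<psi>" using a I \<phi> \<psi> by (simp_all add: cell_def)
  have wb: "cell (\<alpha> \<box> \<alpha>\<sharp>) (\<alpha> \<box> \<alpha>\<sharp>) (\<I> (\<alpha> \<box> \<alpha>\<sharp>)) (\<I> (\<alpha> \<box> \<alpha>\<sharp>)) (\<theta> \<unlhd> \<alpha>\<sharp>)"
    if "cell \<alpha> \<alpha> (\<I> \<alpha>) (\<I> \<alpha>) \<theta>" for \<theta>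
    using cell_rwhisker[OF b that] by (simp add: rwhisker1_id1[OF b a])
  have t: "tilde1 B \<alpha> (\<I> \<alpha>) = \<eta> \<alpha>"
    using hcomp1_unit_left[OF O f(1,2)] by (simp add: tilde1_def rwhisker1_id1[OF b a])
  have w: "(\<phi> \<cdot> \<psi>) \<unlhd> \<alpha>\<sharp> = (\<phi> \<unlhd> \<alpha>\<sharp>) \<cdot> (\<psi> \<unlhd> \<alpha>\<sharp>)" by (rule rwhisker2_vcomp[OF b a a I I I \<psi> \<phi>])
  have "tilde2 B \<alpha> \<phi> \<cdot> tilde2 B \<alpha> \<psi> = ((\<phi> \<cdot> \<psi>) \<unlhd> \<alpha>\<sharp>) \<bullet> \<iota> (\<eta> \<alpha>)"
    using whisker_right_vcomp[OF wb[OF c(2)] wb[OF c(1)] i] by (simp add: tilde2_def w)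
  then have "\<iota> ((\<eta> \<alpha>)\<dagger>) \<bullet> (tilde2 B \<alpha> \<phi> \<cdot> tilde2 B \<alpha> \<psi>) = cofold_End \<alpha> (\<phi> \<cdot> \<psi>) \<bullet> \<iota> (\<eta> \<alpha>)"
    using hcomp_assoc'[OF i wb[OF cell_vcomp[OF c(2,1)]] p(1)] by (simp add: cofold_End_def)
  then show 1: "End_pairing B \<alpha> \<phi> \<psi> = ev B (\<eta> \<alpha>) \<cdot> cofold_coev \<alpha> (\<phi> \<cdot> \<psi>)"
    by (simp add: End_pairing_def t cofold_coev_def Let_def)
  have L: "cell \<O> \<O> ((\<eta> \<alpha>)\<dagger> \<star> \<eta> \<alpha>) ((\<eta> \<alpha>)\<dagger> \<star> \<eta> \<alpha>) (cofold_End \<alpha> \<theta> \<bullet> \<iota> (\<eta> \<alpha>))"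
    if "cell \<alpha> \<alpha> (\<I> \<alpha>) (\<I> \<alpha>) \<theta>" for \<theta>
    by (rule cell_hcomp[OF i cell_cofold_End[OF a that]])
  have "cofold_End \<alpha> (\<phi> \<cdot> \<psi>) \<bullet> \<iota> (\<eta> \<alpha>) =
      (cofold_End \<alpha> \<phi> \<bullet> \<iota> (\<eta> \<alpha>)) \<cdot> (cofold_End \<alpha> \<psi> \<bullet> \<iota> (\<eta> \<alpha>))"
    using whisker_left_vcomp[OF wb[OF c(2)] wb[OF c(1)] p(1)]
      whisker_right_vcomp[OF cell_cofold_End[OF a c(2)] cell_cofold_End[OF a c(1)] i]
    by (simp add: cofold_End_def w)
  then show "End_pairing B \<alpha> \<phi> \<psi> = cofold_ev \<alpha> \<phi> \<cdot> cofold_coev \<alpha> \<psi>"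
    unfolding 1 cofold_ev_def cofold_coev_def
    using vcomp_assoc'[OF p(5) L[OF c(2)] L[OF c(1)]]
      vcomp_assoc'[OF cell_vcomp[OF p(5) L[OF c(2)]] L[OF c(1)] p(2)] by simp
qed

text \<open>The first conclusion is what gives the second its meaning: \<open>scalar_of\<close> is
  defined by \<open>the_inv_into\<close> and is a genuine inverse because \<open>unit_scalar\<close>
  is bijective.\<close>

lemma End_frobenius:
  assumes equiv: "linear_monoidal_equivalence K (endo_monoidal_category B \<O>) (Vect K) F\<^sub>0 F\<^sub>1 \<mu> \<epsilon>"
    and a: "\<alpha> \<in> Obj B"
  shows "bij_betw (unit_scalar B) (carrier K) (carrier (\<H> (\<I> \<O>) (\<I> \<O>)))"
    and "commutative_frobenius_algebra K (End_algebra B (\<I> \<alpha>))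
      (\<lambda>\<phi> \<psi>. scalar_of K B (End_pairing B \<alpha> \<phi> \<psi>))"
proof -
  let ?C = "endo_monoidal_category B \<O>"
  interpret F: linear_monoidal_equivalence K ?C "Vect K" F\<^sub>0 F\<^sub>1 \<mu> \<epsilon> by (rule equiv)
  interpret K: field K by (rule field)
  note O = unit_obj and IO = id1_mor[OF unit_obj] and I = id1_mor[OF a] and f = fold_obj_mor[OF a]
  define V where "V = (\<eta> \<alpha>)\<dagger> \<star> \<eta> \<alpha>"
  let ?H = "\<H> (\<I> \<O>) (\<I> \<O>)" and ?A = "\<H> (\<I> \<alpha>) (\<I> \<alpha>)"
  have V: "V \<in> \<B> \<O> \<O>" using f(4) by (simp add: V_def)
  have [simp]: "MObj ?C = \<B> \<O> \<O>" "MHom ?C = Hom B" "Mid ?C = id2 B" "Mcomp ?C = vcomp B" "Munit ?C = \<I> \<O>"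
    "MHom (Vect K) = Vect_Hom K"
    by (simp_all add: endo_monoidal_category_def Vect_def)
  interpret H: module K ?H by (rule vector_space[OF O O IO IO])
  interpret A: module K ?A by (rule vector_space[OF a a I I])
  have sm: "smult (subspace_of_sequences K W) = smult (sequences K)" for W
    by (simp add: subspace_of_sequences_def)
  obtain E where E_lin: "\<And>X. X \<in> \<B> \<O> \<O> \<Longrightarrow>
      linear_map K (\<H> (\<I> \<O>) X) (subspace_of_sequences K (F\<^sub>0 X)) (E X)"
    and E_bij: "\<And>X. X \<in> \<B> \<O> \<O> \<Longrightarrow> bij_betw (E X) (carrier (\<H> (\<I> \<O>) X)) (F\<^sub>0 X)"
    and E_comp: "\<And>X Y v w. \<lbrakk>X \<in> \<B> \<O> \<O>; Y \<in> \<B> \<O> \<O>; v \<in> carrier (\<H> X Y); w \<in> carrier (\<H> (\<I> \<O>) X)\<rbrakk> \<Longrightarrow>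
      E Y (v \<cdot> w) = snd (snd (F\<^sub>1 X Y v)) (E X w)"
    and E_scalar: "bij_betw (\<lambda>c. c \<odot>\<^bsub>sequences K\<^esub> E (\<I> \<O>) (\<iota> (\<I> \<O>))) (carrier K) (F\<^sub>0 (\<I> \<O>))"
    using hom_from_unit_obtains_eval[OF field equiv] IO id2_hom[OF O O IO] by auto
  have mod: "module K (subspace_of_sequences K (F\<^sub>0 X))" if "X \<in> \<B> \<O> \<O>" for X
    using module_MObj_Vect[OF field F.obj] that by simp
  let ?u = "unit_scalar B" and ?s = "scalar_of K B"
  have u: "?u c = c \<odot>\<^bsub>?H\<^esub> \<iota> (\<I> \<O>)" for c by (simp add: unit_scalar_def)
  have iO: "\<iota> (\<I> \<O>) \<in> carrier ?H" by (rule id2_hom[OF O O IO])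
  \<comment> \<open>By linearity, \<open>E\<close> takes the scalar \<open>c\<close> times the
    identity to \<open>c\<close> times the basis vector of the line
    \<open>F\<^sub>0 (\<I> \<O>)\<close>. Cancelling the bijection \<open>E (\<I> \<O>)\<close>
    leaves the bijectivity of \<open>unit_scalar\<close>.\<close>
  have "bij_betw (E (\<I> \<O>) \<circ> ?u) (carrier K) (F\<^sub>0 (\<I> \<O>))"
    using E_scalar by (rule bij_betw_cong[THEN iffD1, rotated])
      (simp add: u linear_map_smult[OF E_lin[OF IO] _ iO] sm)
  then show u_bij: "bij_betw ?u (carrier K) (carrier ?H)"
    using iO by (subst bij_betw_comp_iff2[OF E_bij[OF IO]]) (auto simp: u)
  have s_u: "?s (?u c) = c" if "c \<in> carrier K" for c
    using u_bij that by (simp add: scalar_of_def the_inv_into_f_f bij_betw_def)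
  have u_s: "?u (?s x) = x" "?s x \<in> carrier K" if "x \<in> carrier ?H" for x
  proof -
    from u_bij that obtain c where "c \<in> carrier K" "x = ?u c" by (auto simp: bij_betw_def)
    then show "?u (?s x) = x" "?s x \<in> carrier K" by (simp_all add: s_u)
  qed
  have s_add: "?s (x \<oplus>\<^bsub>?H\<^esub> y) = ?s x \<oplus>\<^bsub>K\<^esub> ?s y" if "x \<in> carrier ?H" "y \<in> carrier ?H" for x y
    using s_u[of "?s x \<oplus>\<^bsub>K\<^esub> ?s y"] u_s[OF that(1)] u_s[OF that(2)] H.smult_l_distr[OF _ _ iO]
    by (simp add: u)
  have s_smult: "?s (c \<odot>\<^bsub>?H\<^esub> x) = c \<otimes>\<^bsub>K\<^esub> ?s x" if "c \<in> carrier K" "x \<in> carrier ?H" for c x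
    using s_u[of "c \<otimes>\<^bsub>K\<^esub> ?s x"] u_s[OF that(2)] H.smult_assoc1[OF _ _ iO] that by (simp add: u)
  have s_zero: "x = \<zero>\<^bsub>?H\<^esub>" if "x \<in> carrier ?H" "?s x = \<zero>\<^bsub>K\<^esub>" for x
    using u_s[OF that(1)] that(2) H.smult_l_null[OF iO] by (simp add: u)

  \<comment> \<open>The Frobenius trace: the form is \<open>t\<close> of the product, so its
    invariance is associativity of composition.\<close>
  define t where "t \<phi> = ?s (ev B (\<eta> \<alpha>) \<cdot> cofold_coev \<alpha> \<phi>)" for \<phi>
  note coev_lin = cofold_coev_linear[OF a, folded V_def] and ev_lin = cofold_ev_linear[OF a, folded V_def]
  note coev_bij = cofold_coev_bij[OF a, folded V_def]
  have "ev B (\<eta> \<alpha>) \<in> carrier (\<H> V (\<I> \<O>))"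
    using cell_pivotal(2)[OF O f(1,2)] by (simp add: cell_def V_def)
  from linear_map_compose[OF coev_lin vcomp_linear_right[OF O O IO V IO this]]
  have lin: "linear_map K ?A ?H (\<lambda>\<phi>. ev B (\<eta> \<alpha>) \<cdot> cofold_coev \<alpha> \<phi>)" .
  have t_closed: "t \<phi> \<in> carrier K" if "\<phi> \<in> carrier ?A" for \<phi>
    using u_s(2) linear_map_closed[OF lin that] by (simp add: t_def)
  have t_add: "t (\<phi> \<oplus>\<^bsub>?A\<^esub> \<psi>) = t \<phi> \<oplus>\<^bsub>K\<^esub> t \<psi>" if "\<phi> \<in> carrier ?A" "\<psi> \<in> carrier ?A" for \<phi> \<psi>
    using linear_map_add[OF lin that] linear_map_closed[OF lin] that by (simp add: t_def s_add)
  have t_smult: "t (c \<odot>\<^bsub>?A\<^esub> \<phi>) = c \<otimes>\<^bsub>K\<^esub> t \<phi>" if "c \<in> carrier K" "\<phi> \<in> carrier ?A" for c \<phi>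
    using linear_map_smult[OF lin that] linear_map_closed[OF lin] that by (simp add: t_def s_smult)
  have pair: "?s (End_pairing B \<alpha> \<phi> \<psi>) = t (\<phi> \<cdot> \<psi>)" if "\<phi> \<in> carrier ?A" "\<psi> \<in> carrier ?A" for \<phi> \<psi>
    using End_pairing_cofold(1)[OF a that] by (simp add: t_def)
  interpret R: algebra K "End_algebra B (\<I> \<alpha>)" by (rule algebra_End_id[OF a])
  note R_closed = R.m_closed[simplified] and R_comm = R.m_comm[simplified]
  note right_lin = vcomp_linear_right[OF a a I I I] and left_lin = vcomp_linear_left[OF a a I I I]

  have nondeg: "\<phi> = \<zero>\<^bsub>?A\<^esub>" if \<phi>: "\<phi> \<in> carrier ?A"
    and zero: "\<And>\<psi>. \<psi> \<in> carrier ?A \<Longrightarrow> t (\<phi> \<cdot> \<psi>) = \<zero>\<^bsub>K\<^esub>" for \<phi>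
  proof -
    interpret V1: module K "\<H> V (\<I> \<O>)" by (rule vector_space[OF O O V IO])
    let ?v = "cofold_ev \<alpha> \<phi>"
    have v: "?v \<in> carrier (\<H> V (\<I> \<O>))" by (rule linear_map_closed[OF ev_lin \<phi>])
    \<comment> \<open>Every \<open>w\<close> in Hom(1, V) is some
      \<open>cofold_coev \<alpha> \<psi>\<close>, so \<open>?v \<cdot> w\<close> is the pairing of
      \<phi> with \<psi>. The zero 2-morphism is treated alongside so that its image under
      \<open>F\<^sub>1\<close> can be compared with that of \<open>?v\<close> vector by
      vector.\<close>
    have comp0: "\<theta> \<cdot> w = \<zero>\<^bsub>?H\<^esub>" if "\<theta> = ?v \<or> \<theta> = \<zero>\<^bsub>\<H> V (\<I> \<O>)\<^esub>" "w \<in> carrier (\<H> (\<I> \<O>) V)" for \<theta> w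
    proof -
      from that(2) obtain \<psi> where \<psi>: "\<psi> \<in> carrier ?A" "w = cofold_coev \<alpha> \<psi>"
        using coev_bij by (auto simp: bij_betw_def)
      have "?v \<cdot> w \<in> carrier ?H"
        by (rule linear_map_closed[OF vcomp_linear_right[OF O O IO V IO v] that(2)])
      moreover have "?s (?v \<cdot> w) = \<zero>\<^bsub>K\<^esub>"
        using zero[OF \<psi>(1)] pair[OF \<phi> \<psi>(1)] End_pairing_cofold(2)[OF a \<phi> \<psi>(1)] \<psi>(2) by simp
      ultimately have "?v \<cdot> w = \<zero>\<^bsub>?H\<^esub>" by (rule s_zero)
      moreover have "\<zero>\<^bsub>\<H> V (\<I> \<O>)\<^esub> \<cdot> w = \<zero>\<^bsub>?H\<^esub>"
        by (rule linear_map_zero[OF vcomp_linear_left[OF O O IO V IO that(2)]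
              V1.abelian_group_axioms H.abelian_group_axioms])
      ultimately show ?thesis using that(1) by auto
    qed
    have Fv: "F\<^sub>1 V (\<I> \<O>) \<theta> \<in> carrier (Vect_Hom K (F\<^sub>0 V) (F\<^sub>0 (\<I> \<O>)))" if "\<theta> \<in> carrier (\<H> V (\<I> \<O>))" for \<theta>
      using linear_map_closed[OF F.linear, of V "\<I> \<O>" \<theta>] V IO that by simp
    \<comment> \<open>Each vector of \<open>F\<^sub>0 V\<close> is \<open>E V w\<close> for some
      \<open>w\<close>, and by \<open>E_comp\<close> the value there is \<open>E\<close> of a
      composite that \<open>comp0\<close> makes zero. Faithfulness then gives \<open>?v\<close> =
      0.\<close>
    have "F\<^sub>1 V (\<I> \<O>) ?v = F\<^sub>1 V (\<I> \<O>) \<zero>\<^bsub>\<H> V (\<I> \<O>)\<^esub>"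
    proof (rule Vect_Hom_eqI[OF Fv[OF v] Fv[OF V1.zero_closed]])
      fix x assume "x \<in> F\<^sub>0 V"
      then obtain w where w: "w \<in> carrier (\<H> (\<I> \<O>) V)" "x = E V w"
        using E_bij[OF V] by (auto simp: bij_betw_def)
      show "snd (snd (F\<^sub>1 V (\<I> \<O>) ?v)) x = snd (snd (F\<^sub>1 V (\<I> \<O>) \<zero>\<^bsub>\<H> V (\<I> \<O>)\<^esub>)) x"
        using E_comp[OF V IO v w(1)] E_comp[OF V IO V1.zero_closed w(1)] comp0 w by simp
    qed
    then have "?v = \<zero>\<^bsub>\<H> V (\<I> \<O>)\<^esub>"
      using F.fully_faithful[of V "\<I> \<O>"] V IO v by (auto simp: bij_betw_def dest: inj_onD)
    also have "\<dots> = cofold_ev \<alpha> \<zero>\<^bsub>?A\<^esub>"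
      by (rule linear_map_zero[OF ev_lin A.abelian_group_axioms V1.abelian_group_axioms, symmetric])
    finally show ?thesis using inj_onD[OF cofold_ev_inj[OF a]] \<phi> by blast
  qed

  have FV: "finite_dimensional K (subspace_of_sequences K (F\<^sub>0 V))"
    using F.obj[of V] V by (simp add: Vect_def)
  have "bij_betw (\<lambda>\<phi>. E V (cofold_coev \<alpha> \<phi>)) (carrier ?A) (F\<^sub>0 V)"
    using bij_betw_trans[OF coev_bij E_bij[OF V]] by (simp add: comp_def)
  then have "finite_dimensional K ?A"
    using finite_dimensional_linear_bij[OF A.module_axioms mod[OF V] linear_map_compose[OF coev_lin E_lin[OF V]] _ FV]
    by simp
  \<comment> \<open>Replacing the fields \<open>mult\<close> and \<open>one\<close> changes neither
    the finite sums nor the scalar action.\<close>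
  then have fin: "finite_dimensional K (End_algebra B (\<I> \<alpha>))"
    by (simp add: finite_dimensional_def finsum_def End_algebra_def)

  show "commutative_frobenius_algebra K (End_algebra B (\<I> \<alpha>)) (\<lambda>\<phi> \<psi>. ?s (End_pairing B \<alpha> \<phi> \<psi>))"
  proof (intro commutative_frobenius_algebra.intro commutative_frobenius_algebra_axioms.intro)
    \<comment> \<open>Nondegeneracy in the second argument reduces to \<open>nondeg\<close> by
      commutativity of the algebra.\<close>
    fix \<phi> assume "\<phi> \<in> carrier (End_algebra B (\<I> \<alpha>))"
      and "\<And>\<psi>. \<psi> \<in> carrier (End_algebra B (\<I> \<alpha>)) \<Longrightarrow> ?s (End_pairing B \<alpha> \<psi> \<phi>) = \<zero>\<^bsub>K\<^esub>"
    then show "\<phi> = \<zero>\<^bsub>End_algebra B (\<I> \<alpha>)\<^esub>"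
      using nondeg[of \<phi>] by (simp add: pair R_comm[of \<phi>])
  next
    fix \<phi> assume "\<phi> \<in> carrier (End_algebra B (\<I> \<alpha>))"
      and "\<And>\<psi>. \<psi> \<in> carrier (End_algebra B (\<I> \<alpha>)) \<Longrightarrow> ?s (End_pairing B \<alpha> \<phi> \<psi>) = \<zero>\<^bsub>K\<^esub>"
    then show "\<phi> = \<zero>\<^bsub>End_algebra B (\<I> \<alpha>)\<^esub>"
      using nondeg[of \<phi>] by (simp add: pair)
  qed (simp_all add: R.algebra_axioms field fin pair R_closed t_closed t_add t_smult R.m_assoc[simplified]
      linear_map_add[OF right_lin] linear_map_add[OF left_lin] linear_map_smult[OF right_lin]
      linear_map_smult[OF left_lin])
qed

end

theorem theorem3p2:
  fixes K :: "('k, 'r) ring_scheme"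
    and B :: "('k, 'o, 'm, 'c, 'z) monoidal_2cat_scheme"
  assumes "field K"
    and "monoidal_2category_with_duals K B"
    and "linear_monoidally_equivalent K (endo_monoidal_category B (unit_obj B)) (Vect K)"
    and "\<alpha> \<in> Obj B"
  shows "bij_betw (unit_scalar B) (carrier K)
           (carrier (Hom B (id1 B (unit_obj B)) (id1 B (unit_obj B)))) \<and>
         commutative_frobenius_algebra K (End_algebra B (id1 B \<alpha>))
           (\<lambda>\<phi>\<^sub>1 \<phi>\<^sub>2. scalar_of K B (End_pairing B \<alpha> \<phi>\<^sub>1 \<phi>\<^sub>2))"
proof -
  interpret monoidal_2category_with_duals K B by fact
  from assms(3) show ?thesis
    unfolding linear_monoidally_equivalent_def using End_frobenius[OF _ assms(4)] by blast
qed

end
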